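(* Let $p(z)=a_0z^n+a_1z^{n-1}+\dots+a_n$ be a real polynomial of degree $n\geqslant 1$ with $a_0>0$. Then $p$ is self-interlacing of type I if and only if $$(-1)^{\left[\frac{n+1}2\right]}a_n>0,\ (-1)^{\left[\frac{n+1}2\right]-1}a_{n-2}>0,\ (-1)^{\left[\frac{n+1}2\right]-2}a_{n-4}>0,\ \dots$$ or $$(-1)^{\left[\frac{n+1}2\right]}a_n>0,\ (-1)^{\left[\frac{n+1}2\right]-1}a_{n-1}>0,\ (-1)^{\left[\frac{n+1}2\right]-2}a_{n-3}>0,\ \dots$$ and, in addition, one of the following two conditions holds: 1) $\Delta_{n-1}(p)>0,\ \Delta_{n-3}(p)>0,\ \Delta_{n-5}(p)>0,\ \dots$; 2) $(-1)^{\left[\frac{n+1}2\right]}\Delta_{n}(p)>0,\ (-1)^{\left[\frac{n+1}2\right]-1}\Delta_{n-2}(p)>0,\ (-1)^{\left[\frac{n+1}2\right]-2}\Delta_{n-4}(p)>0,\ \ldots$ (That is: [first or second list of coefficient inequalities] and [1) or 2)]; any of the four combinations is equivalent to $p$ being self-interlacing of type I.) The lists of coefficient inequalities run over all indices $\geqslant0$, and the lists of determinant inequalities over all indices $\geqslant1$, of the indicated parity.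
   Context: A real polynomial $p$ of degree $n$ is self-interlacing of type I if all its zeroes $\lambda_1,\dots,\lambda_n$ are real and simple and, suitably numbered, satisfy $0<\lambda_1<-\lambda_2<\lambda_3<\dots<(-1)^{n-1}\lambda_n$. Put $a_i=0$ for $i<0$ and $i>n$. The Hurwitz determinant $\Delta_j(p)$ ($1\leqslant j\leqslant n$) is the determinant of the $j\times j$ matrix whose $(r,s)$ entry is $a_{2s-r}$, i.e. with first rows $(a_1,a_3,a_5,\dots)$, $(a_0,a_2,a_4,\dots)$, $(0,a_1,a_3,\dots)$, $(0,a_0,a_2,\dots)$, etc. $[\rho]$ denotes the largest integer not exceeding $\rho$. *)

theory Defs
  imports
    "HOL-Analysis.Analysis"
    "HOL-Computational_Algebra.Polynomial"
    "Jordan_Normal_Form.Determinant"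
begin

text \<open>
  The zeroes meant are the complex ones, so that their reality is part of the notion. The
  numbering \<open>l 1, ..., l n\<close> with \<open>n = degree p\<close> starts at 1, and the chain
  \<open>0 < l 1 < - l 2 < l 3 < ... < (-1)^(n-1) * l n\<close> is stated link by link.
\<close>
definition self_interlacing_I :: "real poly \<Rightarrow> bool" where
  "self_interlacing_I p \<longleftrightarrow>
     (\<forall>z. poly (map_poly complex_of_real p) z = 0 \<longrightarrow>
        z \<in> \<real> \<and> order z (map_poly complex_of_real p) = 1) \<and>
     (\<exists>l :: nat \<Rightarrow> real.
        bij_betw l {1..degree p} {x. poly p x = 0} \<and>
        0 < l 1 \<and>
        (\<forall>i\<in>{1..<degree p}. (-1) ^ (i - 1) * l i < (-1) ^ i * l (i + 1)))"

text \<open>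
  Coefficients are numbered from the leading one downwards:
  \<open>p(z) = a_0 z^n + a_1 z^(n-1) + ... + a_n\<close>, and \<open>a_i = 0\<close> for \<open>i < 0\<close> and \<open>i > n\<close>.
\<close>
definition desc_coeff :: "real poly \<Rightarrow> int \<Rightarrow> real" where
  "desc_coeff p i =
     (if 0 \<le> i \<and> i \<le> int (degree p) then coeff p (degree p - nat i) else 0)"

text \<open>
  Matrix indices in \<open>mat\<close> start at 0, hence the shift in the entry \<open>a_(2s-r)\<close>.
\<close>
definition hurwitz_matrix :: "real poly \<Rightarrow> nat \<Rightarrow> real mat" where
  "hurwitz_matrix p j =
     mat j j (\<lambda>(r, s). desc_coeff p (2 * (int s + 1) - (int r + 1)))"

definition hurwitz_det :: "real poly \<Rightarrow> nat \<Rightarrow> real" where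
  "hurwitz_det p j = Determinant.det (hurwitz_matrix p j)"

text \<open>
  In the four lists below \<open>n = degree p\<close> and \<open>(n + 1) div 2\<close> is \<open>[(n+1)/2]\<close>. The guards on
  \<open>k\<close> keep coefficient indices \<open>\<ge> 0\<close> and determinant indices \<open>\<ge> 1\<close>; under them the natural
  number subtractions in exponents and determinant indices never truncate.
\<close>

text \<open>\<open>a_n, a_(n-2), a_(n-4), ...\<close>\<close>
definition coeff_signs_1 :: "real poly \<Rightarrow> bool" where
  "coeff_signs_1 p \<longleftrightarrow>
     (let n = degree p in
       \<forall>k. 2 * k \<le> n \<longrightarrow>
         (-1) ^ ((n + 1) div 2 - k) * desc_coeff p (int n - 2 * int k) > 0)"

text \<open>\<open>a_n\<close>, followed by \<open>a_(n-1), a_(n-3), a_(n-5), ...\<close>\<close>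
definition coeff_signs_2 :: "real poly \<Rightarrow> bool" where
  "coeff_signs_2 p \<longleftrightarrow>
     (let n = degree p in
       (-1) ^ ((n + 1) div 2) * desc_coeff p (int n) > 0 \<and>
       (\<forall>k\<ge>1. 2 * k - 1 \<le> n \<longrightarrow>
         (-1) ^ ((n + 1) div 2 - k) * desc_coeff p (int n - (2 * int k - 1)) > 0))"

text \<open>\<open>Delta_(n-1), Delta_(n-3), Delta_(n-5), ...\<close>\<close>
definition det_signs_1 :: "real poly \<Rightarrow> bool" where
  "det_signs_1 p \<longleftrightarrow>
     (let n = degree p in
       \<forall>k. 2 * k + 1 < n \<longrightarrow> hurwitz_det p (n - (2 * k + 1)) > 0)"

text \<open>\<open>Delta_n, Delta_(n-2), Delta_(n-4), ...\<close>\<close>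
definition det_signs_2 :: "real poly \<Rightarrow> bool" where
  "det_signs_2 p \<longleftrightarrow>
     (let n = degree p in
       \<forall>k. 2 * k < n \<longrightarrow>
         (-1) ^ ((n + 1) div 2 - k) * hurwitz_det p (n - 2 * k) > 0)"

end

theory Submission
  imports Defs "Jordan_Normal_Form.Char_Poly"
    "HOL-Computational_Algebra.Fundamental_Theorem_Algebra"
begin

text \<open>
  Everything is reduced to one relation. A pair \<open>(A, B)\<close> of real polynomials is called interlaced
  when \<open>A\<close> has \<open>degree A\<close> distinct real roots and \<open>B\<close> has at each of them the sign of the
  derivative of \<open>A\<close>; equivalently, all residues of \<open>B / A\<close> are positive.

  Self-interlacing of type I says exactly that \<open>(p(z), - p(-z))\<close> is interlaced
  (lemma \<open>self_interlacing_iff_interlaced\<close>): the product of \<open>- p(-x)\<close> and \<open>p'(x)\<close> at a root \<open>x\<close>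
  is, up to a positive factor, \<open>\<plusminus> x\<close> times the product of \<open>x\<^sup>2 - y\<^sup>2\<close> over the other roots \<open>y\<close>, and
  so it records the sign of \<open>x\<close> together with the rank of \<open>\<bar>x\<bar>\<close>.

  Being interlaced is, for coprime pairs, the same as \<open>B / A\<close> mapping the upper half-plane into the
  lower one (lemmas \<open>interlaced_imp_nevanlinna\<close>, \<open>nevanlinna_imp_interlaced\<close>). This makes the
  relation invariant under real Moebius maps of positive determinant applied to \<open>B / A\<close>. One such
  map replaces \<open>p(z)\<close> and \<open>- p(-z)\<close> by the even and odd parts of \<open>p\<close> (lemma
  \<open>interlaced_rotate\<close>), so that with \<open>p(z) = f(z\<^sup>2) + z g(z\<^sup>2)\<close> or \<open>p(z) = z f(z\<^sup>2) + g(z\<^sup>2)\<close>,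
  according to the parity of the degree, self-interlacing means: \<open>(f, g)\<close> respectively
  \<open>(u f, - g)\<close> is interlaced and all roots of \<open>f\<close> are positive.

  Another such map, \<open>B / A\<close> to \<open>- A / B\<close>, gives a Euclidean descent for interlaced pairs: \<open>(G, H)\<close> is
  interlaced iff \<open>(H, K)\<close> is, where \<open>- K\<close> is the remainder of \<open>G\<close> by \<open>H\<close>. The Hurwitz determinants
  follow the same descent, \<open>\<Delta>(2k+3)\<close> of \<open>(G, H)\<close> being a positive multiple of \<open>\<Delta>(2k+1)\<close> of \<open>(H, K)\<close>
  (lemma \<open>hdet_euclid_step\<close>). Hence an interlaced pair is recognised by the positivity of its
  odd-order determinants (lemma \<open>interlaced_iff_hdet\<close>). Applied to \<open>(f, g)\<close>, \<open>(f, u g)\<close>,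
  \<open>(f, - g)\<close> and \<open>(u f, - g)\<close> this turns each of the two determinant conditions into an interlacing
  condition, for each parity of the degree.

  What is left is to see that either list of coefficient signs upgrades either of these interlacing
  conditions to positivity of all roots of \<open>f\<close>. Alternating coefficients exclude roots \<open>\<le> 0\<close>. If it
  is the other polynomial of the pair whose coefficients alternate, its sign on the negative axis is
  known, and this contradicts the sign of \<open>f'\<close> at the smallest root, or at the largest negative
  root, of \<open>f\<close>. Conversely partial fractions with positive residues and nonnegative
  poles force all the coefficient signs.
\<close>

section \<open>Hurwitz determinants of a pair of coefficient sequences\<close>

text \<open>
  The rows are \<open>g, f\<close>, then both shifted by one place, and so on; \<open>f\<close> and \<open>g\<close> are the coefficients
  of the even and of the odd index, read from the top. With sequences over the integers that vanish
  at negative indices, the elimination steps below need no degree bookkeeping.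
\<close>
definition hdet :: "nat \<Rightarrow> (int \<Rightarrow> real) \<Rightarrow> (int \<Rightarrow> real) \<Rightarrow> real" where
  "hdet j f g = Determinant.det
     (mat j j (\<lambda>(r, s). (if even r then g else f) (int s - int (r div 2))))"

lemma det_add_previous_rows:
  fixes M :: "nat \<Rightarrow> nat \<Rightarrow> 'a :: comm_ring_1"
  shows "Determinant.det (mat n n (\<lambda>(r, s). M r s + (if odd r then c * M (r - 1) s else 0)))
       = Determinant.det (mat n n (\<lambda>(r, s). M r s))"
proof -
  define N where
    "N t = mat n n (\<lambda>(r, s). M r s + (if odd r \<and> r < t then c * M (r - 1) s else 0))" for t
  have "Determinant.det (N t) = Determinant.det (N 0)" for t
  proof (induction t)
    case (Suc t)
    have "Determinant.det (N (Suc t)) = Determinant.det (N t)"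
    proof (cases "odd t \<and> t < n")
      case True
      then have t: "0 < t" by (auto intro: Nat.gr0I)
      have "N (Suc t) = addrow c t (t - 1) (N t)"
        using True t by (intro eq_matI) (auto simp: N_def mat_addrow_gen_def less_Suc_eq)
      moreover have "Determinant.det (addrow c t (t - 1) (N t)) = Determinant.det (N t)"
        using True t by (intro det_addrow[where n = n]) (auto simp: N_def)
      ultimately show ?thesis by simp
    next
      case False
      then have "N (Suc t) = N t"
        by (intro eq_matI) (auto simp: N_def less_Suc_eq)
      then show ?thesis by simp
    qed
    with Suc show ?case by simp
  qed simp
  from this[of n] have "Determinant.det (N n) = Determinant.det (N 0)" .
  moreover have "N n = mat n n (\<lambda>(r, s). M r s + (if odd r then c * M (r - 1) s else 0))"
    by (intro eq_matI) (auto simp: N_def)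
  moreover have "N 0 = mat n n (\<lambda>(r, s). M r s)"
    by (intro eq_matI) (auto simp: N_def)
  ultimately show ?thesis by simp
qed

lemma det_swap_row_pairs:
  fixes M :: "nat \<Rightarrow> nat \<Rightarrow> 'a :: comm_ring_1"
  shows "Determinant.det (mat (2 * k) (2 * k) (\<lambda>(r, s). M (if even r then Suc r else r - 1) s))
       = (-1) ^ k * Determinant.det (mat (2 * k) (2 * k) (\<lambda>(r, s). M r s))"
proof -
  define N where "N t = mat (2 * k) (2 * k)
    (\<lambda>(r, s). M (if r < 2 * t then if even r then Suc r else r - 1 else r) s)" for t
  have "t \<le> k \<Longrightarrow> Determinant.det (N t) = (-1) ^ t * Determinant.det (N 0)" for t
  proof (induction t)
    case (Suc t)
    have "N (Suc t) = swaprows (2 * t) (2 * t + 1) (N t)"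
      using Suc.prems by (intro eq_matI) (auto simp: N_def mat_swaprows_def less_Suc_eq)
    then have "Determinant.det (N (Suc t)) = - Determinant.det (N t)"
      using Suc.prems by (simp add: det_swaprows[where n = "2 * k"] N_def)
    with Suc show ?case by simp
  qed simp
  from this[of k] have "Determinant.det (N k) = (-1) ^ k * Determinant.det (N 0)" by simp
  moreover have "N k = mat (2 * k) (2 * k) (\<lambda>(r, s). M (if even r then Suc r else r - 1) s)"
    by (intro eq_matI) (auto simp: N_def)
  moreover have "N 0 = mat (2 * k) (2 * k) (\<lambda>(r, s). M r s)"
    by (intro eq_matI) (auto simp: N_def)
  ultimately show ?thesis by simp
qed

text \<open>
  One step of the Routh scheme. Subtracting \<open>c\<close> times each \<open>g\<close>-row from the \<open>f\<close>-row below it leaves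
  \<open>g 0\<close> as the only entry of the first column, and the remaining minor has again the shape of a
  Hurwitz matrix.
\<close>
lemma hdet_Routh_step:
  assumes g: "\<And>i. i < 0 \<Longrightarrow> g i = 0" and f: "\<And>i. i < 0 \<Longrightarrow> f i = 0" and c: "f 0 = c * g 0"
  shows "hdet (Suc j) f g = g 0 * hdet j g (\<lambda>i. f (i + 1) - c * g (i + 1))"
proof -
  define M where "M r s = (if even r then g else f) (int s - int (r div 2))" for r s
  define N where "N r s = M r s + (if odd r then - c * M (r - 1) s else 0)" for r s
  define A where "A = mat (Suc j) (Suc j) (\<lambda>(r, s). N r s)"
  have "hdet (Suc j) f g = Determinant.det (mat (Suc j) (Suc j) (\<lambda>(r, s). M r s))"
    by (simp add: hdet_def M_def)
  also have "\<dots> = Determinant.det A"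
    unfolding A_def N_def by (rule det_add_previous_rows[symmetric])
  also have "\<dots> = (\<Sum>i<Suc j. A $$ (i, 0) * cofactor A i 0)"
    by (rule laplace_expansion_column) (auto simp: A_def)
  also have "\<dots> = A $$ (0, 0) * cofactor A 0 0"
  proof -
    have "A $$ (i, 0) = 0" if i: "i < Suc j" "0 < i" for i
    proof (cases "i = 1")
      case True
      then show ?thesis using i c by (simp add: A_def N_def M_def)
    next
      case False
      then have "i div 2 > 0" "odd i \<Longrightarrow> (i - 1) div 2 > 0" using i by presburger+
      then show ?thesis using i f g by (simp add: A_def N_def M_def)
    qed
    then have "(\<Sum>i<Suc j. A $$ (i, 0) * cofactor A i 0)
             = (\<Sum>i\<in>{0}. A $$ (i, 0) * cofactor A i 0)"
      by (intro sum.mono_neutral_right) auto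
    then show ?thesis by simp
  qed
  also have "A $$ (0, 0) = g 0"
    by (simp add: A_def N_def M_def)
  also have "cofactor A 0 0 = hdet j g (\<lambda>i. f (i + 1) - c * g (i + 1))"
  proof -
    have "mat_delete A 0 0 = mat j j (\<lambda>(r, s).
        (if even r then (\<lambda>i. f (i + 1) - c * g (i + 1)) else g) (int s - int (r div 2)))"
      by (intro eq_matI)
        (auto simp: A_def N_def M_def mat_delete_def algebra_simps elim!: evenE oddE)
    then show ?thesis by (simp add: cofactor_def hdet_def)
  qed
  finally show ?thesis .
qed

lemma hdet_swap: "hdet (2 * k) f g = (-1) ^ k * hdet (2 * k) g f"
proof -
  define M where "M r s = (if even r then f else g) (int s - int (r div 2))" for r s :: nat
  have "mat (2 * k) (2 * k) (\<lambda>(r, s). (if even r then g else f) (int s - int (r div 2)))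
      = mat (2 * k) (2 * k) (\<lambda>(r, s). M (if even r then Suc r else r - 1) s)"
    by (intro eq_matI) (auto simp: M_def elim!: oddE)
  then show ?thesis
    unfolding hdet_def by (simp only: det_swap_row_pairs) (simp add: M_def)
qed

text \<open>
  Order \<open>2k + 1\<close> has \<open>k\<close> rows built from \<open>f\<close> and \<open>k + 1\<close> rows built from \<open>g\<close>.
\<close>
lemma hdet_scale: "hdet (2 * k + 1) (\<lambda>i. a * f i) (\<lambda>i. b * g i) = a ^ k * b ^ (k + 1) * hdet (2 * k + 1) f g"
proof -
  let ?n = "2 * k + 1"
  define c where "c i = (if even i then b else a)" for i :: nat
  define M where "M = mat ?n ?n (\<lambda>(r, s). (if even r then g else f) (int s - int (r div 2)))"
  define N where "N = mat ?n ?n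
    (\<lambda>(r, s). (if even r then (\<lambda>i. b * g i) else (\<lambda>i. a * f i)) (int s - int (r div 2)))"
  have c: "prod c {0..<?n} = a ^ k * b ^ (k + 1)"
    by (induction k) (auto simp: c_def)
  have row: "(\<Prod>i = 0..<?n. N $$ (i, p i)) = a ^ k * b ^ (k + 1) * (\<Prod>i = 0..<?n. M $$ (i, p i))"
    if "p permutes {0..<?n}" for p
  proof -
    have "p i < ?n" if "i < ?n" for i
      using permutes_in_image[OF \<open>p permutes _\<close>, of i] that by simp
    then have "(\<Prod>i = 0..<?n. N $$ (i, p i)) = (\<Prod>i = 0..<?n. c i * M $$ (i, p i))"
      by (intro prod.cong) (auto simp: N_def M_def c_def)
    then show ?thesis by (simp only: prod.distrib c)
  qed
  have car: "M \<in> carrier_mat ?n ?n" "N \<in> carrier_mat ?n ?n" by (simp_all add: M_def N_def)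
  have "Determinant.det N = a ^ k * b ^ (k + 1) * Determinant.det M"
    unfolding det_def'[OF car(1)] det_def'[OF car(2)] sum_distrib_left
    by (intro sum.cong) (simp_all only: row mem_Collect_eq mult.left_commute)
  then show ?thesis by (simp add: hdet_def M_def N_def)
qed

section \<open>Interlacing pairs and the upper half-plane\<close>

abbreviation (input) cpoly :: "real poly \<Rightarrow> complex \<Rightarrow> complex" where
  "cpoly A z \<equiv> poly (map_poly complex_of_real A) z"

text \<open>
  The roots of \<open>B\<close> do not occur: for a real-rooted \<open>A\<close> with simple roots, agreement of \<open>B\<close> with the
  sign of the derivative of \<open>A\<close> at consecutive roots already forces a root of \<open>B\<close> between them.
\<close>
definition interlaced :: "real poly \<Rightarrow> real poly \<Rightarrow> bool" where
  "interlaced A B \<longleftrightarrow> card {x. poly A x = 0} = degree A \<and>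
     (\<forall>x. poly A x = 0 \<longrightarrow> poly B x * poly (pderiv A) x > 0)"

text \<open>
  The quotient \<open>B / A\<close> maps the upper half-plane to the lower one; \<open>B * cnj A\<close> has the same argument
  and avoids the division. The half-plane condition survives multiplication of \<open>A\<close> and \<open>B\<close> by a
  common factor with real roots, hence the second clause.
\<close>
definition nevanlinna :: "real poly \<Rightarrow> real poly \<Rightarrow> bool" where
  "nevanlinna A B \<longleftrightarrow> (\<forall>z. Im z > 0 \<longrightarrow> Im (cpoly B z * cnj (cpoly A z)) < 0) \<and>
     (\<forall>x. poly A x = 0 \<longrightarrow> poly B x \<noteq> 0)"

interpretation cpoly_hom: map_poly_inj_idom_hom complex_of_real ..

lemma cpoly_simps:
  "cpoly (A + B) z = cpoly A z + cpoly B z"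
  "cpoly (A - B) z = cpoly A z - cpoly B z"
  "cpoly (- A) z = - cpoly A z"
  "cpoly (A * B) z = cpoly A z * cpoly B z"
  "cpoly (Polynomial.smult c A) z = of_real c * cpoly A z"
  "cpoly (pCons c A) z = of_real c + z * cpoly A z"
  "cpoly (A ^ k) z = cpoly A z ^ k"
  "cpoly 0 z = 0"
  "cpoly A (of_real x) = of_real (poly A x)"
  by (simp_all add: cpoly_hom.hom_add cpoly_hom.hom_minus cpoly_hom.hom_uminus cpoly_hom.hom_mult
      cpoly_hom.hom_power map_poly_pCons of_real_hom.map_poly_pCons_hom of_real_hom.map_poly_hom_smult)

lemma cpoly_cnj: "cpoly A (cnj z) = cnj (cpoly A z)"
  by (rule poly_cnj_real[symmetric]) (simp add: coeff_map_poly)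

lemma cpoly_prod: "cpoly (prod f T) z = (\<Prod>t\<in>T. cpoly (f t) z)"
  by (induction T rule: infinite_finite_induct) (simp_all add: cpoly_hom.hom_mult)

lemma cpoly_sum: "cpoly (sum f T) z = (\<Sum>t\<in>T. cpoly (f t) z)"
  by (induction T rule: infinite_finite_induct) (simp_all add: cpoly_hom.hom_add)

lemma rsquarefree_cpoly:
  assumes "\<And>z. cpoly A z = 0 \<Longrightarrow> z \<in> \<real>" "\<And>x. poly A x = 0 \<Longrightarrow> poly (pderiv A) x \<noteq> 0"
  shows "rsquarefree (map_poly complex_of_real A)"
  unfolding rsquarefree_roots
proof safe
  let ?C = "map_poly complex_of_real A"
  fix z assume z: "poly ?C z = 0" "poly (pderiv ?C) z = 0"
  then obtain x where x: "z = of_real x" using assms(1) by (auto elim: Reals_cases)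
  have "pderiv ?C = map_poly of_real (pderiv A)"
    by (simp add: of_real_hom.map_poly_pderiv)
  then have "poly (pderiv A) x = 0" "poly A x = 0" using z x by (simp_all add: cpoly_simps(9))
  then show False using assms(2) by blast
qed

lemma lagrange_interpolation_real:
  fixes R :: "real poly"
  assumes "finite S" "card S = n" "degree R < n"
    "\<And>x. x \<in> S \<Longrightarrow> poly R x = w x * (\<Prod>y\<in>S - {x}. x - y)"
  shows "R = (\<Sum>x\<in>S. Polynomial.smult (w x) (\<Prod>y\<in>S - {x}. [:- y, 1:]))"
proof (rule ccontr)
  let ?T = "\<Sum>x\<in>S. Polynomial.smult (w x) (\<Prod>y\<in>S - {x}. [:- y, 1:])"
  assume neq: "R \<noteq> ?T"
  have "degree ?T \<le> n - 1"
  proof (rule degree_sum_le)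
    fix x assume "x \<in> S"
    have "degree (\<Prod>y\<in>S - {x}. [:- y, 1:]) = n - 1"
      using assms \<open>x \<in> S\<close> by (subst degree_prod_eq_sum_degree) auto
    then show "degree (Polynomial.smult (w x) (\<Prod>y\<in>S - {x}. [:- y, 1:])) \<le> n - 1"
      by (metis degree_smult_le)
  qed (use assms in auto)
  \<comment> \<open>The difference of both sides has more roots than its degree allows.\<close>
  then have deg: "degree (R - ?T) < n" using assms by (intro degree_diff_less) auto
  have "poly (R - ?T) x = 0" if x: "x \<in> S" for x
  proof -
    have "poly ?T x = (\<Sum>z\<in>S. w z * (\<Prod>y\<in>S - {z}. x - y))"
      by (simp add: poly_sum poly_prod)
    also have "\<dots> = (\<Sum>z\<in>{x}. w z * (\<Prod>y\<in>S - {z}. x - y))"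
      using assms x by (intro sum.mono_neutral_right) (auto simp: prod_zero_iff)
    finally show ?thesis using assms x by simp
  qed
  then have "card S \<le> card {x. poly (R - ?T) x = 0}"
    using neq by (intro card_mono poly_roots_finite) auto
  also have "\<dots> \<le> degree (R - ?T)" using neq by (intro card_poly_roots_bound) auto
  finally show False using deg assms by simp
qed

lemma real_rooted_factor:
  fixes A :: "real poly"
  assumes "A \<noteq> 0" "card {x. poly A x = 0} = degree A"
  shows "A = Polynomial.smult (lead_coeff A) (\<Prod>x | poly A x = 0. [:- x, 1:])"
proof (rule ccontr)
  let ?S = "{x. poly A x = 0}"
  let ?P = "\<Prod>x\<in>?S. [:- x, 1:]" and ?T = "Polynomial.smult (lead_coeff A) (\<Prod>x | poly A x = 0. [:- x, 1:])"
  assume neq: "A \<noteq> ?T"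
  have fin: "finite ?S" using assms poly_roots_finite by blast
  have dP: "degree ?P = degree A"
    by (subst degree_prod_eq_sum_degree) (auto simp: assms(2))
  moreover have "lead_coeff ?P = 1" by (simp add: lead_coeff_prod)
  ultimately have c: "coeff ?T (degree A) = coeff A (degree A)" by simp
  have "degree A \<noteq> 0"
  proof
    assume "degree A = 0"
    then obtain a where a: "A = [:a:]" by (auto elim: degree_eq_zeroE)
    with assms have "?S = {}" by auto
    then show False using neq a by simp
  qed
  have "degree (A - ?T) \<le> degree A" by (intro degree_diff_le) (auto simp: dP)
  moreover have "coeff (A - ?T) (degree A) = 0" using c by simp
  ultimately have deg: "degree (A - ?T) < degree A" using neq 
    by (metis eq_iff_diff_eq_0 leading_coeff_0_iff le_neq_implies_less)
  have "card ?S \<le> card {x. poly (A - ?T) x = 0}"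
    using neq fin by (intro card_mono poly_roots_finite) (auto simp: poly_prod)
  also have "\<dots> \<le> degree (A - ?T)" using neq by (intro card_poly_roots_bound) auto
  finally show False using deg assms by simp
qed

text \<open>
  Up to the leading coefficient the derivative at a simple root is the product of the differences to
  the other roots, so its sign counts the larger roots.
\<close>
lemma pderiv_at_root:
  fixes A :: "real poly"
  assumes "A \<noteq> 0" "card {x. poly A x = 0} = degree A" "poly A x = 0"
  shows "poly (pderiv A) x = lead_coeff A * (\<Prod>y\<in>{y. poly A y = 0} - {x}. x - y)"
proof -
  let ?S = "{x. poly A x = 0}"
  have fin: "finite ?S" using assms poly_roots_finite by blast
  let ?Q = "\<Prod>y\<in>?S - {x}. [:- y, 1:]"
  have "A = Polynomial.smult (lead_coeff A) (\<Prod>x | poly A x = 0. [:- x, 1:])"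
    using real_rooted_factor assms by blast
  also have "(\<Prod>x | poly A x = 0. [:- x, 1:]) = [:- x, 1:] * ?Q"
    using fin assms by (subst prod.remove[of _ x]) auto
  finally have "pderiv A = pderiv (Polynomial.smult (lead_coeff A) ([:- x, 1:] * ?Q))" by (rule arg_cong)
  then have "poly (pderiv A) x = lead_coeff A * poly ?Q x"
    by (simp only: pderiv_smult pderiv_mult) (simp add: pderiv_pCons)
  then show ?thesis by (simp add: poly_prod)
qed

text \<open>
  The numbers \<open>lead_coeff A * w x\<close> have the sign of the residues of \<open>B / A\<close>, which is why the
  interlacing condition makes them positive.
\<close>
lemma interlaced_partial_fractions:
  assumes "A \<noteq> 0" "interlaced A B" "B = Q * A + R" "R = 0 \<or> degree R < degree A"
  obtains w where "\<And>x. poly A x = 0 \<Longrightarrow> lead_coeff A * w x > 0"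
    "R = (\<Sum>x | poly A x = 0. Polynomial.smult (w x) (\<Prod>y\<in>{y. poly A y = 0} - {x}. [:- y, 1:]))"
proof -
  let ?S = "{x. poly A x = 0}" and ?a = "lead_coeff A"
  have fin: "finite ?S" using assms poly_roots_finite by blast
  have card: "card ?S = degree A" using assms by (simp add: interlaced_def)
  define w where "w x = poly B x / (\<Prod>y\<in>?S - {x}. x - y)" for x
  have pos: "?a * w x > 0" if "poly A x = 0" for x
  proof -
    have *: "poly B x * (?a * (\<Prod>y\<in>?S - {x}. x - y)) > 0"
      using assms that pderiv_at_root[OF assms(1) card that] by (auto simp: interlaced_def)
    have "?a * w x = poly B x * (?a * (\<Prod>y\<in>?S - {x}. x - y)) / (\<Prod>y\<in>?S - {x}. x - y)\<^sup>2"
      using * by (simp add: w_def power2_eq_square)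
    also have "\<dots> > 0" using * by (intro divide_pos_pos) auto
    finally show ?thesis .
  qed
  have nz: "(\<Prod>y\<in>?S - {x}. x - y) \<noteq> 0" for x using fin by simp
  have R: "R = (\<Sum>x\<in>?S. Polynomial.smult (w x) (\<Prod>y\<in>?S - {x}. [:- y, 1:]))"
  proof (cases "degree A = 0")
    case True
    then have "?S = {}" using card fin by simp
    moreover have "R = 0" using assms True by simp
    ultimately show ?thesis by simp
  next
    case False
    then show ?thesis using assms nz
      by (intro lagrange_interpolation_real[OF fin card]) (auto simp: w_def)
  qed
  show thesis by (rule that[OF pos R])
qed

text \<open>
  \<open>B / A\<close> is \<open>c z + d\<close> plus a sum of terms \<open>r / (z - x)\<close> with \<open>r > 0\<close> and real \<open>x\<close>, and every term
  \<open>r / (z - x)\<close> maps the upper half-plane to the lower one, as does \<open>c z\<close> for negative \<open>c\<close>.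
\<close>
lemma interlaced_imp_nevanlinna:
  assumes A: "A \<noteq> 0" and I: "interlaced A B" and B: "B = [:d, c:] * A + R"
    and R: "R = 0 \<or> degree R < degree A" and c: "c < 0 \<or> c = 0 \<and> degree A > 0"
  shows "nevanlinna A B"
proof -
  let ?S = "{x. poly A x = 0}" and ?a = "lead_coeff A"
  obtain w where w: "\<And>x. poly A x = 0 \<Longrightarrow> ?a * w x > 0"
    and Rw: "R = (\<Sum>x | poly A x = 0. Polynomial.smult (w x) (\<Prod>y\<in>?S - {x}. [:- y, 1:]))"
    using interlaced_partial_fractions[OF A I B R] by blast
  have fin: "finite ?S" using A poly_roots_finite by blast
  have card: "card ?S = degree A" using I by (simp add: interlaced_def)
  have lin: "cpoly [:- x, 1:] z = z - of_real x" for x z by (simp add: map_poly_pCons)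
  have "Im (cpoly B z * cnj (cpoly A z)) < 0" if z: "Im z > 0" for z
  proof -
    let ?P = "cpoly A z"
    have Pz: "?P = of_real ?a * (\<Prod>x\<in>?S. z - of_real x)"
      by (subst real_rooted_factor[OF A card]) (simp only: cpoly_simps(5) cpoly_prod lin)
    have zx: "z - of_real x \<noteq> 0" for x using z by (auto simp: complex_eq_iff)
    then have P0: "?P \<noteq> 0" using A fin by (auto simp: Pz)
    have fr: "cpoly R z = ?P * (\<Sum>x\<in>?S. of_real (w x / ?a) / (z - of_real x))"
    proof -
      have "of_real (w x) * (\<Prod>y\<in>?S - {x}. z - of_real y) = ?P * (of_real (w x / ?a) / (z - of_real x))"
        if "x \<in> ?S" for x
      proof -
        have "(\<Prod>x\<in>?S. z - of_real x) = (z - of_real x) * (\<Prod>y\<in>?S - {x}. z - of_real y)"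
          using fin that by (rule prod.remove)
        then have "?P = of_real ?a * ((z - of_real x) * (\<Prod>y\<in>?S - {x}. z - of_real y))"
          by (simp only: Pz)
        then show ?thesis using zx[of x] A by simp
      qed
      then show ?thesis
        by (subst Rw) (simp add: cpoly_sum cpoly_simps(5) cpoly_prod lin sum_distrib_left)
    qed
    have Bz: "cpoly B z = ?P * (of_real d + of_real c * z + (\<Sum>x\<in>?S. of_real (w x / ?a) / (z - of_real x)))"
      (is "_ = ?P * ?q")
      by (subst B) (simp only: cpoly_simps fr, simp add: algebra_simps)
    have neg: "Im (of_real (w x / ?a) / (z - of_real x)) < 0" if "x \<in> ?S" for x
    proof -
      have "w x / ?a = (?a * w x) / ?a\<^sup>2" by (simp add: power2_eq_square)
      also have "\<dots> > 0" using w that A by (intro divide_pos_pos) auto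
      finally have p: "w x / ?a > 0" .
      have "Im (of_real u / (z - of_real x)) = - u * Im z / (cmod (z - of_real x))\<^sup>2" for u
        by (simp add: Im_divide cmod_def)
      then have "Im (of_real (w x / ?a) / (z - of_real x))
          = - (w x / ?a) * Im z / (cmod (z - of_real x))\<^sup>2" .
      also have "\<dots> < 0" using p z zx[of x] by (intro divide_neg_pos mult_neg_pos) auto
      finally show ?thesis .
    qed
    have "Im ?q = c * Im z + (\<Sum>x\<in>?S. Im (of_real (w x / ?a) / (z - of_real x)))" by simp
    also have "\<dots> < 0"
    proof (cases "?S = {}")
      case True
      then have "degree A = 0" using card by simp
      then show ?thesis unfolding True using c z by (simp add: mult_neg_pos)
    next
      case False
      then have "(\<Sum>x\<in>?S. Im (of_real (w x / ?a) / (z - of_real x))) < (\<Sum>x\<in>?S. 0)"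
        using fin neg by (intro sum_strict_mono) auto
      moreover have "c * Im z \<le> 0" using c z by (auto simp: mult_nonpos_nonneg)
      ultimately show ?thesis by simp
    qed
    finally have q: "Im ?q < 0" .
    have "cpoly B z * cnj ?P = of_real ((cmod ?P)\<^sup>2) * ?q"
      unfolding Bz by (subst complex_norm_square) (simp add: mult_ac)
    then have "Im (cpoly B z * cnj ?P) = (cmod ?P)\<^sup>2 * Im ?q" by simp
    also have "\<dots> < 0" using q P0 by (intro mult_pos_neg) auto
    finally show ?thesis .
  qed
  moreover have "poly B x \<noteq> 0" if "poly A x = 0" for x
    using I that by (auto simp: interlaced_def)
  ultimately show ?thesis by (auto simp: nevanlinna_def)
qed

text \<open>
  A root of \<open>A\<close> in the upper half-plane is excluded at once, and by conjugation all roots are real.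
  Near a real root \<open>x\<close> of order \<open>k\<close> the quotient behaves like \<open>C / (z - x)^k\<close>; on the ray of angle
  \<open>t\<close> its imaginary part has the sign of \<open>- C sin (k t)\<close>. This keeps the required sign for all
  \<open>t\<close> between \<open>0\<close> and \<open>pi\<close> only if \<open>k = 1\<close> and \<open>C > 0\<close>.
\<close>
lemma nevanlinna_imp_interlaced:
  assumes A: "A \<noteq> 0" and N: "nevanlinna A B"
  shows "interlaced A B"
proof -
  have key: "poly B x * poly (pderiv A) x > 0" if x: "poly A x = 0" for x
  proof -
    define k where "k = order x A"
    obtain A1 where A1: "A = [:- x, 1:] ^ k * A1" "\<not> [:- x, 1:] dvd A1"
      using order_decomp[OF A] k_def by blast
    have A1x: "poly A1 x \<noteq> 0" using A1(2) by (simp add: poly_eq_0_iff_dvd)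
    have Bx: "poly B x \<noteq> 0" using N x by (auto simp: nevanlinna_def)
    have k: "k > 0" using A x k_def order_root by blast
    \<comment> \<open>Approaching \<open>x\<close> along the ray of angle \<open>t\<close> and dividing by \<open>e ^ k\<close>.\<close>
    have angle: "poly B x * poly A1 x * sin (k * t) \<ge> 0" if t: "0 < t" "t < pi" for t :: real
    proof -
      define h where "h e = Im (cpoly B (of_real x + of_real e * cis t)
          * cnj (cpoly A1 (of_real x + of_real e * cis t) * cis (k * t)))" for e :: real
      have "h e \<le> 0" if e: "e > 0" for e
      proof -
        let ?z = "of_real x + of_real e * cis t"
        have "Im ?z > 0" using e t by (simp add: sin_gt_zero)
        then have "Im (cpoly B ?z * cnj (cpoly A ?z)) < 0" using N by (auto simp: nevanlinna_def)
        moreover have "cpoly A ?z = of_real (e ^ k) * (cpoly A1 ?z * cis (k * t))"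
        proof -
          have "cpoly A ?z = (of_real e * cis t) ^ k * cpoly A1 ?z"
            by (subst A1) (simp add: cpoly_simps)
          then show ?thesis by (simp add: power_mult_distrib Complex.DeMoivre)
        qed
        ultimately have neg: "Im (cpoly B ?z * cnj (of_real (e ^ k) * (cpoly A1 ?z * cis (k * t)))) < 0"
          by (simp only:)
        have im: "Im (v * cnj (of_real r * w)) = r * Im (v * cnj w)" for v w r
          by (simp add: algebra_simps)
        have "e ^ k * h e < 0" using neg unfolding im h_def .
        then show ?thesis using e by (simp add: mult_less_0_iff)
      qed
      then have "\<forall>\<^sub>F e in at_right 0. h e \<le> 0"
        by (auto simp: eventually_at_right_less eventually_at_filter)
      moreover have "(h \<longlongrightarrow> h 0) (at_right 0)"
        unfolding h_def by (intro tendsto_intros)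
      ultimately have "h 0 \<le> 0" by (intro tendsto_upperbound) auto
      then show ?thesis by (simp add: h_def cpoly_simps)
    qed
    \<comment> \<open>The ray on which \<open>sin (k t)\<close> is \<open>1\<close>.\<close>
    have "poly B x * poly A1 x \<ge> 0"
    proof -
      have "poly B x * poly A1 x * sin (k * (pi / (2 * k))) \<ge> 0"
        using k by (intro angle[of "pi / (2 * k)"]) (auto simp: field_simps)
      then show ?thesis using k by simp
    qed
    with A1x Bx have pos: "poly B x * poly A1 x > 0"
      by (simp add: order_less_le)
    have "k = 1"
    proof (rule ccontr)
      assume "k \<noteq> 1"
      \<comment> \<open>From order two on some ray in the upper half-plane gives \<open>sin (k t) = -1\<close>.\<close>
      with k have "k \<ge> 2" by simp
      then have "poly B x * poly A1 x * sin (k * (3 * pi / (2 * k))) \<ge> 0"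
        using pi_gt_zero by (intro angle[of "3 * pi / (2 * k)"]) (auto simp: field_simps)
      moreover have "k * (3 * pi / (2 * k)) = 3/2 * pi" using k by simp
      ultimately have "poly B x * poly A1 x * sin (3/2 * pi) \<ge> 0" by (simp only:)
      then show False using pos sin_3over2_pi by simp
    qed
    then have "A = [:- x, 1:] * A1" using A1(1) by simp
    then have "poly (pderiv A) x = poly A1 x"
      by (simp only: pderiv_mult) (simp add: pderiv_pCons)
    with pos show ?thesis by simp
  qed
  let ?C = "map_poly complex_of_real A"
  have real: "Im z = 0" if "poly ?C z = 0" for z
  proof -
    have "\<not> Im z > 0" using N that by (auto simp: nevanlinna_def)
    moreover have "\<not> Im (cnj z) > 0"
    proof
      assume "Im (cnj z) > 0"
      then have "Im (cpoly B (cnj z) * cnj (cpoly A (cnj z))) < 0"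
        using N unfolding nevanlinna_def by blast
      then show False by (simp only: cpoly_cnj that) simp
    qed
    ultimately show ?thesis by simp
  qed
  have roots: "{z. poly ?C z = 0} = of_real ` {x. poly A x = 0}"
  proof (rule subset_antisym)
    show "{z. poly ?C z = 0} \<subseteq> of_real ` {x. poly A x = 0}"
    proof
      fix z assume "z \<in> {z. poly ?C z = 0}"
      then have z: "poly ?C z = 0" by simp
      then have "z = of_real (Re z)" using real by (simp add: complex_eq_iff)
      with z show "z \<in> of_real ` {x. poly A x = 0}"
        by (metis (mono_tags, lifting) cpoly_simps(9) image_eqI mem_Collect_eq of_real_eq_0_iff)
    qed
  qed (auto simp: cpoly_simps(9))
  have "rsquarefree ?C"
  proof (rule rsquarefree_cpoly)
    show "z \<in> \<real>" if "cpoly A z = 0" for z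
      using real[OF that] by (simp add: complex_is_Real_iff)
    show "poly (pderiv A) x \<noteq> 0" if "poly A x = 0" for x
      using key[OF that] by auto
  qed
  then have "?C = Polynomial.smult (lead_coeff ?C) (\<Prod>z | poly ?C z = 0. [:- z, 1:])"
    by (rule complex_poly_decompose_rsquarefree[symmetric])
  then have "degree ?C = degree (Polynomial.smult (lead_coeff ?C) (\<Prod>z | poly ?C z = 0. [:- z, 1:]))" by (rule arg_cong)
  also have "\<dots> = card {z. poly ?C z = 0}"
    using A by (simp add: degree_prod_eq_sum_degree)
  also have "\<dots> = card {x. poly A x = 0}"
    unfolding roots by (rule card_image) (auto intro: inj_onI)
  finally have "card {x. poly A x = 0} = degree A" by simp
  with key show ?thesis by (simp add: interlaced_def)
qed

section \<open>Interlacing by Hurwitz minors of one parity\<close>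

text \<open>
  The formal degree \<open>d\<close> is an argument because the pairs in question need it to be larger than the
  actual degree at times; it is an integer so that the formal degree \<open>-1\<close> is available.
\<close>
definition coeff_from_top :: "int \<Rightarrow> real poly \<Rightarrow> int \<Rightarrow> real" where
  "coeff_from_top d G i = (if 0 \<le> i \<and> i \<le> d then coeff G (nat (d - i)) else 0)"

lemma linear_quotient:
  fixes G H :: "real poly"
  assumes "H \<noteq> 0" "degree G \<le> degree H + 1"
  obtains d c R where "G = [:d, c:] * H + R" "R = 0 \<or> degree R < degree H"
    "coeff G (degree H + 1) = c * lead_coeff H"
proof -
  define Q R where "Q = G div H" and "R = G mod H"
  have G: "G = Q * H + R" by (simp add: Q_def R_def)
  have R: "R = 0 \<or> degree R < degree H" using degree_mod_less[OF assms(1)] by (simp add: R_def)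
  have "degree Q \<le> 1"
  proof (cases "Q = 0")
    case False
    have "Q * H = G - R" using G by simp
    moreover have "degree (G - R) \<le> degree H + 1"
      using assms R by (intro degree_diff_le) auto
    ultimately have "degree (Q * H) \<le> degree H + 1" by simp
    then show ?thesis using False assms by (simp add: degree_mult_eq)
  qed simp
  then have Q: "Q = [:coeff Q 0, coeff Q 1:]"
    by (intro poly_eqI) (auto simp: coeff_pCons coeff_eq_0 split: nat.splits)
  have "coeff G (degree H + 1) = coeff ([:coeff Q 0, coeff Q 1:] * H) (degree H + 1) + coeff R (degree H + 1)"
    using G Q by (metis coeff_add)
  also have "\<dots> = coeff Q 1 * lead_coeff H"
    using R by (auto simp: coeff_pCons coeff_eq_0)
  finally have c: "coeff G (degree H + 1) = coeff Q 1 * lead_coeff H" .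
  have "G = [:coeff Q 0, coeff Q 1:] * H + R" using G Q by metis
  then show thesis using R c by (rule that)
qed

text \<open>
  Two Routh steps make one division with remainder by \<open>H\<close>. Between them the two kinds of rows have
  to trade places; the sign that this costs cancels against the sign of the remainder.
\<close>
lemma hdet_euclid_step:
  fixes G H K :: "real poly"
  assumes m: "degree H = m" and G: "G = [:d, c:] * H - K" and K: "K = 0 \<or> degree K < m"
  shows "hdet (2 * k + 3) (coeff_from_top (int m + 1) G) (coeff_from_top (int m) H)
       = (lead_coeff H)\<^sup>2 * hdet (2 * k + 1) (coeff_from_top (int m) H) (coeff_from_top (int m - 1) K)"
proof -
  let ?f = "coeff_from_top (int m + 1) G" and ?g = "coeff_from_top (int m) H" and ?k = "coeff_from_top (int m - 1) K"
  have fgk: "?f i = c * ?g i + d * ?g (i - 1) - ?k (i - 2)" for i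
  proof -
    have cK: "coeff K t = 0" if "t \<ge> m" for t using K that by (auto simp: coeff_eq_0)
    have cG: "coeff G t = d * coeff H t + c * (if t = 0 then 0 else coeff H (t - 1)) - coeff K t" for t
      by (auto simp: G coeff_pCons split: nat.splits)
    consider "i < 0" | "i > int m + 1" | "i = int m + 1" | "0 \<le> i \<and> i \<le> int m" by linarith
    then show ?thesis
    proof cases
      case 3
      then show ?thesis by (auto simp: coeff_from_top_def cG cK coeff_eq_0 m)
    next
      case 4
      define t where "t = nat (int m + 1 - i)"
      have t: "t > 0" "int m - i = int (t - 1)" "int m + 1 - i = int t" "int m - (i - 1) = int t"
        "int m - 1 - (i - 2) = int t"
        using 4 by (auto simp: t_def)
      have "?g (i - 1) = coeff H t"
      proof (cases "i = 0")
        case True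
        then show ?thesis using m by (simp add: coeff_from_top_def t_def coeff_eq_0)
      next
        case False
        then have "0 \<le> i - 1 \<and> i - 1 \<le> int m" using 4 by simp
        then show ?thesis unfolding coeff_from_top_def t(4) by simp
      qed
      moreover have "?k (i - 2) = coeff K t"
        using 4 t cK by (auto simp: coeff_from_top_def)
      moreover have "?g i = coeff H (t - 1)" "?f i = coeff G t"
        using 4 unfolding coeff_from_top_def t(2) t(3) by simp_all
      ultimately show ?thesis using t cG by simp
    qed (auto simp: coeff_from_top_def)
  qed
  have neg: "?f i = 0" "?g i = 0" "?k i = 0" if "i < 0" for i using that by (auto simp: coeff_from_top_def)
  have h: "?g 0 = lead_coeff H" by (simp add: coeff_from_top_def m)
  let ?f1 = "\<lambda>i. d * ?g i - ?k (i - 1)"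
  have "hdet (2 * k + 3) ?f ?g = hdet (Suc (2 * (k + 1))) ?f ?g" by (simp add: numeral_3_eq_3)
  also have "\<dots> = ?g 0 * hdet (2 * (k + 1)) ?g (\<lambda>i. ?f (i + 1) - c * ?g (i + 1))"
    by (intro hdet_Routh_step neg) (auto simp: fgk neg)
  also have "(\<lambda>i. ?f (i + 1) - c * ?g (i + 1)) = ?f1" by (auto simp: fgk)
  also have "hdet (2 * (k + 1)) ?g ?f1 = (-1) ^ (k + 1) * hdet (Suc (2 * k + 1)) ?f1 ?g"
    by (subst hdet_swap) simp
  also have "hdet (Suc (2 * k + 1)) ?f1 ?g
      = ?g 0 * hdet (2 * k + 1) ?g (\<lambda>i. ?f1 (i + 1) - d * ?g (i + 1))"
    by (intro hdet_Routh_step neg) (auto simp: neg)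
  also have "(\<lambda>i. ?f1 (i + 1) - d * ?g (i + 1)) = (\<lambda>i. - 1 * ?k i)" by auto
  also have "hdet (2 * k + 1) ?g (\<lambda>i. - 1 * ?k i) = (-1) ^ (k + 1) * hdet (2 * k + 1) ?g ?k"
    using hdet_scale[of k 1 ?g "-1" ?k] by simp
  finally show ?thesis by (simp add: h power2_eq_square)
qed

text \<open>
  This is the map \<open>w \<mapsto> - 1 / w\<close> on the quotient.
\<close>
lemma nevanlinna_swap: "nevanlinna G H \<longleftrightarrow> nevanlinna H (- G)"
proof -
  have "Im (cpoly (- G) z * cnj (cpoly H z)) = Im (cpoly H z * cnj (cpoly G z))" for z
    by (simp add: cpoly_simps(3))
  then show ?thesis unfolding nevanlinna_def poly_minus by auto
qed

lemma interlaced_cong_mod: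
  assumes "B = Q * A + R"
  shows "interlaced A B \<longleftrightarrow> interlaced A R"
  using assms by (auto simp: interlaced_def)

text \<open>
  Only the remainder of \<open>- G\<close> modulo \<open>H\<close> matters for interlacing, and by the determinant identity only
  the remainder matters for the minors. The determinant criterion for pairs \<open>(H, K)\<close> is a premise, so
  that the lemma serves both as the induction step of the next theorem and, later, as a criterion of its own.
\<close>
lemma interlaced_iff_hdet_euclid:
  assumes H: "lead_coeff H > 0" and G: "degree G \<le> degree H + 1"
    and IH: "\<And>K. K = 0 \<or> degree K < degree H \<Longrightarrow> interlaced H K \<longleftrightarrow>
      (\<forall>k<degree H. hdet (2 * k + 1) (coeff_from_top (int (degree H)) H) (coeff_from_top (int (degree H) - 1) K) > 0)"
  shows "interlaced H (- G) \<longleftrightarrow>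
    (\<forall>k<degree H. hdet (2 * k + 3) (coeff_from_top (int (degree H) + 1) G) (coeff_from_top (int (degree H)) H) > 0)"
proof -
  have H0: "H \<noteq> 0" using H by auto
  obtain d c R where R: "G = [:d, c:] * H + R" "R = 0 \<or> degree R < degree H"
    using linear_quotient[OF H0 G] by blast
  define K where "K = - R"
  have K: "G = [:d, c:] * H - K" "K = 0 \<or> degree K < degree H" using R by (auto simp: K_def)
  have "- G = (- [:d, c:]) * H + K"
    unfolding K(1) mult_minus_left by (rule minus_diff_eq[THEN trans]) (rule diff_conv_add_uminus[THEN trans], rule add.commute)
  then have "interlaced H (- G) \<longleftrightarrow> interlaced H K" by (rule interlaced_cong_mod)
  also have "\<dots> \<longleftrightarrow> (\<forall>k<degree H. hdet (2 * k + 1) (coeff_from_top (int (degree H)) H) (coeff_from_top (int (degree H) - 1) K) > 0)"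
    using K by (intro IH)
  also have "\<dots> \<longleftrightarrow> (\<forall>k<degree H. hdet (2 * k + 3) (coeff_from_top (int (degree H) + 1) G) (coeff_from_top (int (degree H)) H) > 0)"
    using H0 by (simp add: hdet_euclid_step[OF refl K] zero_less_mult_iff)
  finally show ?thesis .
qed

lemma hdet_1: "hdet (Suc 0) f g = g 0"
  by (simp add: hdet_def det_single)

text \<open>
  The leading coefficients enter because the quotient \<open>- G / H\<close> has a pole at infinity, whose
  contribution to the imaginary part must be negative as well.
\<close>
lemma interlaced_swap:
  assumes "lead_coeff G > 0" "lead_coeff H > 0" "degree G = degree H + 1"
  shows "interlaced G H \<longleftrightarrow> interlaced H (- G)"
proof -
  have nz: "G \<noteq> 0" "H \<noteq> 0" using assms by auto
  obtain d c R where R: "G = [:d, c:] * H + R" "R = 0 \<or> degree R < degree H"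
    "coeff G (degree H + 1) = c * lead_coeff H"
    using linear_quotient[OF nz(2)] assms by (metis order_refl)
  have c: "c > 0" using R(3) assms by (simp add: zero_less_mult_iff)
  have "interlaced G H \<longleftrightarrow> nevanlinna G H"
    using interlaced_imp_nevanlinna[OF nz(1), of H 0 0 H] nevanlinna_imp_interlaced[OF nz(1)] assms by auto
  also have "\<dots> \<longleftrightarrow> nevanlinna H (- G)" by (rule nevanlinna_swap)
  also have "\<dots> \<longleftrightarrow> interlaced H (- G)"
  proof -
    have "- G = [:- d, - c:] * H + (- R)" by (subst R(1)) simp
    then show ?thesis
      using interlaced_imp_nevanlinna[OF nz(2), of "- G" "- d" "- c" "- R"] nevanlinna_imp_interlaced[OF nz(2)] R(2) c by auto
  qed
  finally show ?thesis .
qed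

text \<open>
  The coefficient is the sum of the residues times the leading coefficient of \<open>A\<close>.
\<close>
lemma interlaced_coeff_pos:
  assumes "lead_coeff A > 0" "interlaced A B" "B = 0 \<or> degree B < degree A" "degree A > 0"
  shows "coeff B (degree A - 1) > 0"
proof -
  let ?S = "{x. poly A x = 0}"
  have A: "A \<noteq> 0" using assms by auto
  have fin: "finite ?S" using A poly_roots_finite by blast
  have card: "card ?S = degree A" using assms by (simp add: interlaced_def)
  obtain w where w: "\<And>x. poly A x = 0 \<Longrightarrow> lead_coeff A * w x > 0"
    and B: "B = (\<Sum>x\<in>?S. Polynomial.smult (w x) (\<Prod>y\<in>?S - {x}. [:- y, 1:]))"
    using interlaced_partial_fractions[OF A assms(2), of 0 B] assms by auto
  have one: "coeff (\<Prod>y\<in>?S - {x}. [:- y, 1:]) (degree A - 1) = 1" if "x \<in> ?S" for x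
  proof -
    have "degree (\<Prod>y\<in>?S - {x}. [:- y, 1:]) = degree A - 1"
      using that card fin by (subst degree_prod_eq_sum_degree) auto
    moreover have "lead_coeff (\<Prod>y\<in>?S - {x}. [:- y, 1:]) = 1"
      by (simp add: lead_coeff_prod)
    ultimately show ?thesis by simp
  qed
  have ne: "?S \<noteq> {}" using card assms(4) by (metis card.empty less_irrefl)
  have "coeff B (degree A - 1) = (\<Sum>x\<in>?S. w x)"
    by (subst B) (simp add: coeff_sum one[unfolded One_nat_def])
  also have "\<dots> > 0"
    using w assms(1) fin ne by (intro sum_pos) (auto simp: zero_less_mult_iff)
  finally show ?thesis .
qed

text \<open>
  Induction along the Euclidean algorithm for \<open>(G, H)\<close>. The determinant of order one is the formal
  leading coefficient of \<open>H\<close>; its positivity, implied by both sides, is what allows the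
  next division.
\<close>
theorem interlaced_iff_hdet:
  assumes "lead_coeff G > 0" "H = 0 \<or> degree H < degree G"
  shows "interlaced G H \<longleftrightarrow>
    (\<forall>k<degree G. hdet (2 * k + 1) (coeff_from_top (int (degree G)) G) (coeff_from_top (int (degree G) - 1) H) > 0)"
  using assms
proof (induction "degree G" arbitrary: G H)
  case 0
  then obtain a where "G = [:a:]" by (metis degree_eq_zeroE)
  with 0 show ?case by (auto simp: interlaced_def)
next
  case (Suc m)
  note m = Suc.hyps(2)[symmetric]
  let ?D = "\<lambda>j. hdet j (coeff_from_top (int (degree G)) G) (coeff_from_top (int (degree G) - 1) H)"
  have D1: "?D (Suc 0) = coeff H m" by (simp add: hdet_1 coeff_from_top_def m)
  show ?case
  proof (cases "coeff H m > 0")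
    case False
    then have "\<not> interlaced G H" using interlaced_coeff_pos[of G H] Suc.prems m by auto
    moreover have "\<not> (\<forall>k<degree G. ?D (2 * k + 1) > 0)"
      using False D1 m by (metis One_nat_def add_0 mult_0_right zero_less_Suc)
    ultimately show ?thesis by blast
  next
    case True
    then have "degree H = m" using Suc.prems m le_degree[of H m] by fastforce
    then have dH: "degree H = m" "lead_coeff H > 0" using True by auto
    have "interlaced G H \<longleftrightarrow> interlaced H (- G)"
      using Suc.prems dH m by (intro interlaced_swap) auto
    also have "\<dots> \<longleftrightarrow> (\<forall>k<degree H. hdet (2 * k + 3) (coeff_from_top (int (degree H) + 1) G) (coeff_from_top (int (degree H)) H) > 0)"
      using dH m by (intro interlaced_iff_hdet_euclid Suc.hyps(1)) auto
    also have "\<dots> \<longleftrightarrow> (\<forall>k<m. ?D (2 * Suc k + 1) > 0)"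
      by (simp add: dH m add_ac numeral_3_eq_3)
    also have "\<dots> \<longleftrightarrow> (\<forall>k<degree G. ?D (2 * k + 1) > 0)"
      using True D1 m by (simp only: m All_less_Suc2) simp
    finally show ?thesis .
  qed
qed

lemmas interlaced_uminus_iff_hdet = interlaced_iff_hdet_euclid[OF _ _ interlaced_iff_hdet]

section \<open>Self-interlacing as interlacing with the reflected polynomial\<close>

lemma nevanlinna_iff_interlaced:
  assumes "degree A > 0" "B = Polynomial.smult d A + R" "R = 0 \<or> degree R < degree A"
  shows "nevanlinna A B \<longleftrightarrow> interlaced A B"
proof -
  have "A \<noteq> 0" using assms(1) by auto
  then show ?thesis
    using interlaced_imp_nevanlinna[of A B d 0 R] nevanlinna_imp_interlaced[of A B] assms by auto
qed

text \<open>
  For \<open>s = 1\<close> and \<open>s = -1\<close> the new quotient \<open>(B - s A) / (A + s B)\<close> is a real Moebius image of \<open>B / A\<close>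
  with determinant \<open>2\<close>, a rotation by an eighth of a turn up to scaling, so it keeps the half-plane
  condition. For the even and odd parts of \<open>p\<close> it produces \<open>p\<close> and its reflection.
\<close>
lemma interlaced_rotate:
  assumes "degree B < degree A" and s: "s * s = 1"
  shows "interlaced (A + Polynomial.smult s B) (B - Polynomial.smult s A) \<longleftrightarrow> interlaced A B"
proof -
  let ?p = "A + Polynomial.smult s B" and ?q = "B - Polynomial.smult s A"
  have ss: "s * (s * t) = t" for t by (simp only: mult.assoc[symmetric] s mult_1)
  have Im: "Im ((b - of_real s * a) * cnj (a + of_real s * b)) = 2 * Im (b * cnj a)" for a b
    by (simp add: algebra_simps ss)
  have deg: "degree ?p = degree A"
    using assms(1) by (intro degree_add_eq_left) (auto intro: le_less_trans[OF degree_smult_le])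
  have q: "?q = Polynomial.smult (- s) ?p + Polynomial.smult 2 B"
    by (intro poly_eqI) (simp add: algebra_simps ss)
  have "interlaced ?p ?q \<longleftrightarrow> nevanlinna ?p ?q"
    using assms(1) by (intro nevanlinna_iff_interlaced[OF _ q, symmetric]) (auto simp: deg)
  also have "\<dots> \<longleftrightarrow> nevanlinna A B"
  proof -
    have zero: "a = 0 \<and> b = 0" if "a + s * b = 0" "b - s * a = 0" for a b
    proof -
      have "2 * b = (b - s * a) + s * (a + s * b)" by (simp add: algebra_simps ss s)
      then show ?thesis using that by simp
    qed
    have "poly ?p x = 0 \<and> poly ?q x = 0 \<longleftrightarrow> poly A x = 0 \<and> poly B x = 0" for x
      using zero[of "poly A x" "poly B x"] by auto
    moreover have "Im (cpoly ?q z * cnj (cpoly ?p z)) < 0 \<longleftrightarrow> Im (cpoly B z * cnj (cpoly A z)) < 0" for z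
      unfolding cpoly_simps Im by linarith
    ultimately show ?thesis unfolding nevanlinna_def by blast
  qed
  also have "\<dots> \<longleftrightarrow> interlaced A B"
    using assms(1) by (intro nevanlinna_iff_interlaced[of A B 0 B]) auto
  finally show ?thesis .
qed

lemma abs_increasing_enumeration:
  fixes S :: "real set"
  assumes "finite S" "inj_on abs S"
  obtains l where "bij_betw l {1..card S} S"
    "\<And>i j. 1 \<le> i \<Longrightarrow> i < j \<Longrightarrow> j \<le> card S \<Longrightarrow> \<bar>l i\<bar> < \<bar>l j\<bar>"
proof -
  obtain ys where ys: "set ys = S" "distinct ys" using assms(1) finite_distinct_list by blast
  define xs where "xs = sort_key abs ys"
  have xs: "set xs = S" "distinct xs" "sorted (map abs xs)" using ys by (simp_all add: xs_def)
  then have len: "length xs = card S" using distinct_card by fastforce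
  have dm: "distinct (map abs xs)" using xs assms by (simp add: distinct_map)
  define l where "l i = xs ! (i - 1)" for i :: nat
  have "bij_betw (\<lambda>i. i - 1) {1..card S} {..<card S}"
    by (rule bij_betwI[of _ _ _ Suc]) auto
  moreover have "bij_betw ((!) xs) {..<card S} S"
    using xs len by (intro bij_betw_nth) auto
  ultimately have "bij_betw ((!) xs \<circ> (\<lambda>i. i - 1)) {1..card S} S" by (rule bij_betw_trans)
  moreover have "(!) xs \<circ> (\<lambda>i. i - 1) = l" by (auto simp: l_def)
  ultimately have bij: "bij_betw l {1..card S} S" by simp
  have "\<bar>l i\<bar> < \<bar>l j\<bar>" if "1 \<le> i" "i < j" "j \<le> card S" for i j
  proof -
    have "i - 1 < j - 1" "j - 1 < length xs" using that len by auto
    then have "\<bar>l i\<bar> \<le> \<bar>l j\<bar>" "\<bar>l i\<bar> \<noteq> \<bar>l j\<bar>"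
      using sorted_nth_mono[OF xs(3), of "i - 1" "j - 1"] nth_eq_iff_index_eq[OF dm, of "i - 1" "j - 1"]
      by (auto simp: l_def)
    then show ?thesis by simp
  qed
  with bij show thesis by (rule that)
qed

text \<open>
  Exactly the \<open>n - i\<close> factors belonging to a larger absolute value are negative.
\<close>
lemma sgn_prod_square_differences:
  fixes l :: "nat \<Rightarrow> real"
  assumes l: "\<And>i j. 1 \<le> i \<Longrightarrow> i < j \<Longrightarrow> j \<le> n \<Longrightarrow> \<bar>l i\<bar> < \<bar>l j\<bar>" and i: "i \<in> {1..n}"
  shows "(-1) ^ (n - i) * (\<Prod>j\<in>{1..n} - {i}. (l i)\<^sup>2 - (l j)\<^sup>2) > 0"
proof -
  have split: "{1..n} - {i} = {1..<i} \<union> {i<..n}" using i by auto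
  have "(\<Prod>j\<in>{1..n} - {i}. (l i)\<^sup>2 - (l j)\<^sup>2)
      = (\<Prod>j\<in>{1..<i}. (l i)\<^sup>2 - (l j)\<^sup>2) * (\<Prod>j\<in>{i<..n}. (l i)\<^sup>2 - (l j)\<^sup>2)"
    unfolding split by (rule prod.union_disjoint) auto
  also have "(\<Prod>j\<in>{i<..n}. (l i)\<^sup>2 - (l j)\<^sup>2) = (\<Prod>j\<in>{i<..n}. (-1) * ((l j)\<^sup>2 - (l i)\<^sup>2))"
    by (intro prod.cong) auto
  also have "\<dots> = (-1) ^ (n - i) * (\<Prod>j\<in>{i<..n}. (l j)\<^sup>2 - (l i)\<^sup>2)"
    by (simp only: prod.distrib prod_constant card_greaterThanAtMost)
  finally have "(-1) ^ (n - i) * (\<Prod>j\<in>{1..n} - {i}. (l i)\<^sup>2 - (l j)\<^sup>2)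
      = (\<Prod>j\<in>{1..<i}. (l i)\<^sup>2 - (l j)\<^sup>2) * (\<Prod>j\<in>{i<..n}. (l j)\<^sup>2 - (l i)\<^sup>2)"
    by (simp flip: power_mult_distrib add: power_add[symmetric] mult_ac)
  also have "\<dots> > 0"
    using i l by (intro mult_pos_pos prod_pos) (auto simp: abs_le_square_iff[symmetric] not_le simp flip: not_le)
  finally show ?thesis .
qed

lemma real_rooted_complex_roots:
  assumes "A \<noteq> 0" "card {x. poly A x = 0} = degree A" "cpoly A z = 0"
  shows "z \<in> \<real>" "order z (map_poly complex_of_real A) = 1"
proof -
  let ?C = "map_poly complex_of_real A" and ?S = "{x. poly A x = 0}"
  have fin: "finite ?S" using assms poly_roots_finite by blast
  have real: "z \<in> \<real>" if "cpoly A z = 0" for z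
  proof -
    have lin: "cpoly [:- x, 1:] z = z - of_real x" for x by (simp add: map_poly_pCons)
    have "cpoly A z = of_real (lead_coeff A) * (\<Prod>x\<in>?S. z - of_real x)"
      by (subst real_rooted_factor[OF assms(1,2)]) (simp only: cpoly_simps(5) cpoly_prod lin)
    with that assms(1) fin show ?thesis by auto
  qed
  then show "z \<in> \<real>" using assms(3) .
  have "rsquarefree ?C"
  proof (rule rsquarefree_cpoly[OF real])
    show "poly (pderiv A) x \<noteq> 0" if "poly A x = 0" for x
      using pderiv_at_root[OF assms(1,2) that] assms(1) fin by simp
  qed
  then show "order z ?C = 1" using assms by (intro rsquarefree_root_order) auto
qed

lemma signed_pos_eq_abs: "(-1) ^ k * x > 0 \<Longrightarrow> (-1) ^ k * x = \<bar>x :: real\<bar>"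
  by (cases "even k") auto

text \<open>
  Let \<open>l\<close> list the roots of \<open>p\<close> by increasing absolute value. The sign of \<open>q p'\<close> at \<open>l i\<close> is that of
  \<open>(-1)^(i-1) * l i\<close>, because \<open>p(-x) p'(x)\<close> is a multiple of the product of \<open>x\<^sup>2 - y\<^sup>2\<close> over the
  other roots \<open>y\<close>. So the interlacing condition says that the signs of the roots alternate along
  this list, starting with a positive one, which is the chain in the definition.
\<close>
lemma self_interlacing_iff_interlaced:
  assumes deg: "degree p > 0" and q: "\<And>x. poly q x = - poly p (- x)"
  shows "self_interlacing_I p \<longleftrightarrow> interlaced p q"
proof -
  let ?S = "{x. poly p x = 0}" and ?n = "degree p" and ?a = "lead_coeff p"
  have p: "p \<noteq> 0" using deg by auto
  have fin: "finite ?S" using p poly_roots_finite by blast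
  have key: "poly q (l i) * poly (pderiv p) (l i) > 0 \<longleftrightarrow> (-1) ^ (i - 1) * l i > 0"
    if l: "bij_betw l {1..?n} ?S" "\<And>i j. 1 \<le> i \<Longrightarrow> i < j \<Longrightarrow> j \<le> ?n \<Longrightarrow> \<bar>l i\<bar> < \<bar>l j\<bar>"
      and i: "i \<in> {1..?n}" for l :: "nat \<Rightarrow> real" and i
  proof -
    have card: "card ?S = ?n" using bij_betw_same_card[OF l(1)] by simp
    let ?x = "l i" and ?P = "\<Prod>j\<in>{1..?n} - {i}. (l i)\<^sup>2 - (l j)\<^sup>2"
    have x: "?x \<in> ?S" using l(1) i by (auto simp: bij_betw_def)
    have "poly p (- ?x) = ?a * (\<Prod>y\<in>?S. - ?x - y)"
      by (subst real_rooted_factor[OF p card]) (simp add: poly_prod, intro disjI2 prod.cong, auto)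
    also have "(\<Prod>y\<in>?S. - ?x - y) = (- ?x - ?x) * (\<Prod>y\<in>?S - {?x}. - ?x - y)"
      using fin x by (rule prod.remove)
    finally have px: "poly p (- ?x) = ?a * ((- ?x - ?x) * (\<Prod>y\<in>?S - {?x}. - ?x - y))" .
    have "(\<Prod>y\<in>?S - {?x}. - ?x - y) * (\<Prod>y\<in>?S - {?x}. ?x - y)
        = (\<Prod>y\<in>?S - {?x}. (-1) * (?x\<^sup>2 - y\<^sup>2))"
      unfolding prod.distrib[symmetric] by (intro prod.cong) (auto simp: power2_eq_square algebra_simps)
    also have "\<dots> = (-1) ^ (?n - 1) * (\<Prod>y\<in>?S - {?x}. ?x\<^sup>2 - y\<^sup>2)"
      using fin x card by (simp only: prod.distrib prod_constant) simp
    also have "(\<Prod>y\<in>?S - {?x}. ?x\<^sup>2 - y\<^sup>2) = ?P"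
    proof -
      have "bij_betw l ({1..?n} - {i}) (?S - {?x})"
        using l(1) i by (intro bij_betw_DiffI) (auto simp: bij_betw_def)
      from prod.reindex_bij_betw[OF this, of "\<lambda>y. ?x\<^sup>2 - y\<^sup>2"] show ?thesis by simp
    qed
    finally have PP: "(\<Prod>y\<in>?S - {?x}. - ?x - y) * (\<Prod>y\<in>?S - {?x}. ?x - y) = (-1) ^ (?n - 1) * ?P" .
    have "poly q ?x * poly (pderiv p) ?x
        = 2 * ?a\<^sup>2 * ?x * ((\<Prod>y\<in>?S - {?x}. - ?x - y) * (\<Prod>y\<in>?S - {?x}. ?x - y))"
      using x by (simp add: q px pderiv_at_root[OF p card] power2_eq_square algebra_simps)
    also have "\<dots> = 2 * ?a\<^sup>2 * ((-1) ^ (?n - 1) * ?x) * ?P" unfolding PP by (simp only: mult_ac)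
    also have "?n - 1 = (i - 1) + (?n - i)" using i by auto
    also have "(-1 :: real) ^ ((i - 1) + (?n - i)) = (-1) ^ (i - 1) * (-1) ^ (?n - i)"
      by (rule power_add)
    finally have "poly q ?x * poly (pderiv p) ?x
        = (2 * ?a\<^sup>2 * ((-1) ^ (?n - i) * ?P)) * ((-1) ^ (i - 1) * ?x)" by (simp only: mult_ac)
    moreover have "2 * ?a\<^sup>2 * ((-1) ^ (?n - i) * ?P) > 0"
    proof (rule mult_pos_pos)
      show "(-1) ^ (?n - i) * ?P > 0" by (rule sgn_prod_square_differences[OF l(2) i])
    qed (use p in simp)
    ultimately show ?thesis by (metis zero_less_mult_pos mult_pos_pos)
  qed
  show ?thesis
  proof
    assume "self_interlacing_I p"
    then obtain l where bij: "bij_betw l {1..?n} ?S" and l1: "0 < l 1"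
      and chain: "\<And>i. i \<in> {1..<?n} \<Longrightarrow> (-1) ^ (i - 1) * l i < (-1) ^ i * l (i + 1)"
      unfolding self_interlacing_I_def by blast
    define u where "u i = (-1) ^ (i - 1) * l i" for i
    have step: "u i < u (Suc i)" if "1 \<le> i" "Suc i \<le> ?n" for i
      using chain[of i] that by (simp add: u_def)
    have mono: "u i < u j" if "1 \<le> i" "i < j" "j \<le> ?n" for i j
      using that(2,3)
    proof (induction j)
      case (Suc j)
      with that(1) step[of j] show ?case by (cases "i = j") auto
    qed simp
    have pos: "u i > 0" if "i \<in> {1..?n}" for i
      using mono[of 1 i] that l1 by (cases "i = 1") (auto simp: u_def)
    have "\<bar>l i\<bar> = u i" if "i \<in> {1..?n}" for i
      using pos[OF that] unfolding u_def by (rule signed_pos_eq_abs[symmetric])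
    then have inc: "\<bar>l i\<bar> < \<bar>l j\<bar>" if "1 \<le> i" "i < j" "j \<le> ?n" for i j
      using mono[OF that] that by auto
    have "poly q x * poly (pderiv p) x > 0" if "poly p x = 0" for x
    proof -
      have "x \<in> l ` {1..?n}" using bij that by (simp add: bij_betw_def)
      then obtain i where i: "i \<in> {1..?n}" "x = l i" by blast
      have "poly q (l i) * poly (pderiv p) (l i) > 0 \<longleftrightarrow> (-1) ^ (i - 1) * l i > 0"
        by (rule key[OF bij inc i(1)])
      then show ?thesis unfolding i(2) using pos[OF i(1)] unfolding u_def by (rule iffD2)
    qed
    moreover have "card ?S = ?n" using bij_betw_same_card[OF bij] by simp
    ultimately show "interlaced p q" by (auto simp: interlaced_def)
  next
    assume I: "interlaced p q"
    then have card: "card ?S = ?n" by (simp add: interlaced_def)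
    \<comment> \<open>Two roots \<open>x\<close> and \<open>- x\<close> would make \<open>q\<close> vanish at a root of \<open>p\<close>.\<close>
    have "inj_on abs ?S"
    proof (rule inj_onI, rule ccontr)
      fix x y assume xy: "x \<in> ?S" "y \<in> ?S" "\<bar>x\<bar> = \<bar>y\<bar>" "x \<noteq> y"
      then have "y = - x" by (auto simp: abs_if split: if_splits)
      then have "poly q x = 0" using xy by (simp add: q)
      moreover have "poly q x * poly (pderiv p) x > 0" using I xy by (auto simp: interlaced_def)
      ultimately show False by simp
    qed
    then obtain l where bij: "bij_betw l {1..?n} ?S"
      and inc: "\<And>i j. 1 \<le> i \<Longrightarrow> i < j \<Longrightarrow> j \<le> ?n \<Longrightarrow> \<bar>l i\<bar> < \<bar>l j\<bar>"
      using abs_increasing_enumeration[OF fin] unfolding card by blast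
    have pos: "(-1) ^ (i - 1) * l i > 0" if "i \<in> {1..?n}" for i
    proof -
      have "l i \<in> ?S" using bij that by (auto simp: bij_betw_def)
      then show ?thesis using key[OF bij inc that] I by (auto simp: interlaced_def)
    qed
    then have ab: "(-1) ^ (i - 1) * l i = \<bar>l i\<bar>" if "i \<in> {1..?n}" for i
      using that by (intro signed_pos_eq_abs) auto
    have "(-1) ^ (i - 1) * l i < (-1) ^ i * l (i + 1)" if "i \<in> {1..<?n}" for i
      using ab[of i] ab[of "i + 1"] inc[of i "i + 1"] that by simp
    moreover have "0 < l 1" using pos[of 1] deg by simp
    ultimately show "self_interlacing_I p"
      unfolding self_interlacing_I_def
    proof (intro conjI allI impI exI[of _ l] ballI bij)
      fix z assume "cpoly p z = 0"
      then show "z \<in> \<real>" "order z (map_poly complex_of_real p) = 1"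
        by (rule real_rooted_complex_roots[OF p card])+
    qed
  qed
qed

section \<open>Even and odd parts as polynomials in the square of the variable\<close>

abbreviation sq :: "real poly" where "sq \<equiv> [:0, 0, 1:]"

text \<open>
  Only positive elements have two real square roots. Comparing with the degree, this forces all roots of
  \<open>f\<close> to be positive as soon as \<open>f(z\<^sup>2)\<close> has enough real roots.
\<close>
lemma card_square_preimage:
  fixes X :: "real set"
  assumes "finite X"
  shows "card {z. z\<^sup>2 \<in> X} = 2 * card {x \<in> X. x > 0} + (if 0 \<in> X then 1 else 0)"
proof -
  let ?P = "{x \<in> X. x > 0}" and ?Z = "if 0 \<in> X then {0} else {} :: real set"
  have "{z. z\<^sup>2 \<in> X} = (sqrt ` ?P \<union> (\<lambda>x. - sqrt x) ` ?P) \<union> ?Z" (is "?L = ?R")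
  proof (rule subset_antisym)
    show "?L \<subseteq> ?R"
    proof
      fix z assume z: "z \<in> ?L"
      consider "z = 0" | "z > 0" | "z < 0" by linarith
      then show "z \<in> ?R"
      proof cases
        case 2
        then have "z = sqrt (z\<^sup>2)" "z\<^sup>2 \<in> ?P" using z by auto
        then show ?thesis by blast
      next
        case 3
        then have "z = - sqrt (z\<^sup>2)" "z\<^sup>2 \<in> ?P" using z by auto
        then show ?thesis by blast
      qed (use z in auto)
    qed
  qed auto
  moreover have "card (sqrt ` ?P) = card ?P" "card ((\<lambda>x. - sqrt x) ` ?P) = card ?P"
    by (rule card_image, auto intro: inj_onI)+
  moreover have "sqrt ` ?P \<inter> (\<lambda>x. - sqrt x) ` ?P = {}"
  proof -
    have "sqrt x \<noteq> - sqrt y" if "x > 0" "y > 0" for x y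
      using that real_sqrt_gt_zero[of x] real_sqrt_gt_zero[of y] by linarith
    then show ?thesis by blast
  qed
  moreover have "(sqrt ` ?P \<union> (\<lambda>x. - sqrt x) ` ?P) \<inter> ?Z = {}" by auto
  ultimately show ?thesis
    using assms by (simp add: card_Un_disjoint)
qed

lemma poly_sq: "poly (pcompose f sq) z = poly f (z\<^sup>2)"
  by (simp add: poly_pcompose power2_eq_square)

lemma poly_pderiv_sq: "poly (pderiv (pcompose f sq)) z = 2 * z * poly (pderiv f) (z\<^sup>2)"
  by (simp add: pderiv_pcompose poly_sq pderiv_pCons)

text \<open>
  At \<open>z\<close> with \<open>f(z\<^sup>2) = 0\<close> the product of \<open>z g(z\<^sup>2)\<close> with the derivative of \<open>f(z\<^sup>2)\<close> is \<open>2 z\<^sup>2\<close> times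
  \<open>g f'\<close> taken at \<open>z\<^sup>2\<close>.
\<close>
lemma interlaced_square_even:
  assumes f: "f \<noteq> 0"
  shows "interlaced (pcompose f sq) (pCons 0 (pcompose g sq)) \<longleftrightarrow>
    interlaced f g \<and> (\<forall>x. poly f x = 0 \<longrightarrow> x > 0)" (is "interlaced ?A ?B \<longleftrightarrow> _")
proof -
  let ?X = "{x. poly f x = 0}" and ?P = "{x. poly f x = 0 \<and> x > 0}"
  have fin: "finite ?X" using f poly_roots_finite by blast
  have dA: "degree ?A = 2 * degree f" by (simp add: degree_pcompose)
  have cA: "card {z. poly ?A z = 0} = 2 * card ?P + (if poly f 0 = 0 then 1 else 0)"
    using card_square_preimage[OF fin] by (simp add: poly_sq)
  have val: "poly ?B z * poly (pderiv ?A) z = 2 * z\<^sup>2 * (poly g (z\<^sup>2) * poly (pderiv f) (z\<^sup>2))" for z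
    by (simp add: poly_sq poly_pderiv_sq power2_eq_square)
  show ?thesis
  proof
    assume I: "interlaced ?A ?B"
    have pos: "2 * z\<^sup>2 * (poly g (z\<^sup>2) * poly (pderiv f) (z\<^sup>2)) > 0" if "poly f (z\<^sup>2) = 0" for z
      using I that unfolding interlaced_def val by (simp add: poly_sq)
    have "poly f 0 \<noteq> 0" using pos[of 0] by auto
    then have "card ?P = degree f" using I cA dA by (simp add: interlaced_def)
    moreover have "card ?X \<le> degree f" using f by (rule card_poly_roots_bound)
    ultimately have eq: "?P = ?X" using fin by (intro card_seteq) auto
    have "poly g x * poly (pderiv f) x > 0" if x: "poly f x = 0" for x
    proof -
      have "x > 0" using eq x by blast
      then show ?thesis using pos[of "sqrt x"] x by (simp add: zero_less_mult_iff)
    qed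
    moreover have "card ?X = degree f" using \<open>card ?P = degree f\<close> eq by simp
    ultimately show "interlaced f g \<and> (\<forall>x. poly f x = 0 \<longrightarrow> x > 0)"
      using eq by (auto simp: interlaced_def)
  next
    assume R: "interlaced f g \<and> (\<forall>x. poly f x = 0 \<longrightarrow> x > 0)"
    then have "?P = ?X" by auto
    then have "card {z. poly ?A z = 0} = degree ?A" using R cA dA by (auto simp: interlaced_def)
    moreover have "poly ?B z * poly (pderiv ?A) z > 0" if "poly ?A z = 0" for z
    proof -
      have "2 * z\<^sup>2 > 0" "poly g (z\<^sup>2) * poly (pderiv f) (z\<^sup>2) > 0"
        using R that by (auto simp: interlaced_def poly_sq)
      then show ?thesis unfolding val by (rule mult_pos_pos)
    qed
    ultimately show "interlaced ?A ?B" by (simp add: interlaced_def)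
  qed
qed

text \<open>
  The extra root \<open>0\<close> of \<open>z f(z\<^sup>2)\<close> corresponds to the root \<open>0\<close> of \<open>u f(u)\<close>; at the other roots the
  argument is that of the even case.
\<close>
lemma interlaced_square_odd:
  assumes f: "f \<noteq> 0"
  shows "interlaced (pCons 0 (pcompose f sq)) (pcompose h sq) \<longleftrightarrow>
    interlaced (pCons 0 f) h \<and> (\<forall>x. poly f x = 0 \<longrightarrow> x > 0)" (is "interlaced ?A ?B \<longleftrightarrow> _")
proof -
  let ?F = "pCons 0 f"
  let ?X = "{x. poly ?F x = 0}" and ?P = "{x. poly ?F x = 0 \<and> x > 0}"
  have F: "?F \<noteq> 0" using f by simp
  have fin: "finite ?X" using F poly_roots_finite by blast
  have dA: "degree ?A = 2 * degree f + 1" using f by (simp add: degree_pcompose pcompose_eq_0_iff)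
  have dF: "degree ?F = degree f + 1" using f by simp
  have "{z. poly ?A z = 0} = {z. z\<^sup>2 \<in> ?X}" by (auto simp: poly_sq)
  then have cA: "card {z. poly ?A z = 0} = 2 * card ?P + 1"
    using card_square_preimage[OF fin] by simp
  have dvA: "poly (pderiv ?A) z = poly f (z\<^sup>2) + 2 * z\<^sup>2 * poly (pderiv f) (z\<^sup>2)" for z
    by (simp add: pderiv_pCons poly_sq poly_pderiv_sq power2_eq_square)
  have dvF: "poly (pderiv ?F) x = poly f x + x * poly (pderiv f) x" for x
    by (simp add: pderiv_pCons)
  show ?thesis
  proof
    assume I: "interlaced ?A ?B"
    have pos: "poly h (z\<^sup>2) * (poly f (z\<^sup>2) + 2 * z\<^sup>2 * poly (pderiv f) (z\<^sup>2)) > 0"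
      if "z = 0 \<or> poly f (z\<^sup>2) = 0" for z
    proof -
      have "poly ?A z = 0" using that by (auto simp: poly_sq)
      then have "poly ?B z * poly (pderiv ?A) z > 0" using I unfolding interlaced_def by blast
      then show ?thesis unfolding dvA poly_sq .
    qed
    have "card ?P + 1 = degree ?F" using I cA dA dF by (simp add: interlaced_def)
    moreover have "card (insert 0 ?P) = card ?P + 1"
      using fin by (subst card_insert_disjoint) (auto intro: rev_finite_subset)
    moreover have "card ?X \<le> degree ?F" using F by (rule card_poly_roots_bound)
    ultimately have eq: "insert 0 ?P = ?X" using fin by (intro card_seteq) auto
    have f0: "poly h 0 * poly f 0 > 0" using pos[of 0] by simp
    have x0: "x > 0" if "poly f x = 0" for x
      using eq that f0 by (cases "x = 0") auto
    have "poly h x * poly (pderiv ?F) x > 0" if x: "poly ?F x = 0" for x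
    proof (cases "x = 0")
      case True
      then show ?thesis using f0 by (simp add: dvF)
    next
      case False
      then have "poly f x = 0" "x > 0" using x x0 by auto
      then show ?thesis using pos[of "sqrt x"] by (simp add: dvF zero_less_mult_iff)
    qed
    moreover have "card ?X = degree ?F"
      using \<open>card ?P + 1 = degree ?F\<close> \<open>card (insert 0 ?P) = card ?P + 1\<close> eq by simp
    ultimately show "interlaced ?F h \<and> (\<forall>x. poly f x = 0 \<longrightarrow> x > 0)"
      using x0 by (auto simp: interlaced_def)
  next
    assume R: "interlaced ?F h \<and> (\<forall>x. poly f x = 0 \<longrightarrow> x > 0)"
    have posF: "poly h x * (poly f x + x * poly (pderiv f) x) > 0" if "poly ?F x = 0" for x
      using R that by (auto simp: interlaced_def dvF)
    have "?X = insert 0 ?P" using R by auto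
    then have "card ?X = card ?P + 1"
      using fin by (simp add: card_insert_disjoint)
    then have "card {z. poly ?A z = 0} = degree ?A" using R cA dA dF by (auto simp: interlaced_def)
    moreover have "poly ?B z * poly (pderiv ?A) z > 0" if z: "poly ?A z = 0" for z
    proof (cases "z = 0")
      case True
      then show ?thesis using posF[of 0] by (simp add: dvA poly_sq)
    next
      case False
      then have "poly f (z\<^sup>2) = 0" using z by (simp add: poly_sq)
      then show ?thesis using posF[of "z\<^sup>2"] False by (simp add: dvA poly_sq zero_less_mult_iff)
    qed
    ultimately show "interlaced ?A ?B" by (simp add: interlaced_def)
  qed
qed

section \<open>Coefficient signs and the signs of the roots\<close>

text \<open>
  The sign pattern of a monic polynomial of degree \<open>m\<close> with positive roots. The formal degree \<open>m\<close>
  fixes the overall sign.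
\<close>
definition alternating :: "nat \<Rightarrow> real poly \<Rightarrow> bool" where
  "alternating m f \<longleftrightarrow> (\<forall>k\<le>m. (-1) ^ (m - k) * coeff f k > 0)"

text \<open>
  At \<open>x \<le> 0\<close> no term of \<open>(-1)^m f(x)\<close> is negative, and the constant one is positive.
\<close>
lemma alternating_sign:
  assumes "alternating m f" "degree f \<le> m" "x \<le> 0"
  shows "(-1) ^ m * poly f x > 0"
proof -
  have "poly f x = (\<Sum>k\<le>m. coeff f k * x ^ k)"
    using assms(2) unfolding poly_altdef by (intro sum.mono_neutral_left) (auto simp: coeff_eq_0)
  also have "(-1) ^ m * \<dots> = (\<Sum>k\<le>m. ((-1) ^ (m - k) * coeff f k) * (- x) ^ k)"
    unfolding sum_distrib_left
  proof (intro sum.cong refl)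
    fix k assume "k \<in> {..m}"
    then have "(-1 :: real) ^ m = (-1) ^ (m - k) * (-1) ^ k" by (simp flip: power_add)
    then show "(-1) ^ m * (coeff f k * x ^ k) = (-1) ^ (m - k) * coeff f k * (- x) ^ k"
      by (simp add: power_minus[of x])
  qed
  also have "\<dots> > 0"
  proof (rule sum_pos2[of _ 0])
    show "0 < (-1) ^ (m - 0) * coeff f 0 * (- x) ^ 0"
      using assms(1) by (auto simp: alternating_def)
    show "0 \<le> (-1) ^ (m - k) * coeff f k * (- x) ^ k" if "k \<in> {..m}" for k
      using assms that by (intro mult_nonneg_nonneg[of "_ * _"]) (auto simp: alternating_def less_imp_le)
  qed auto
  finally show ?thesis .
qed

text \<open>
  Multiplication by \<open>u - a\<close> preserves the sign pattern: both contributions to a coefficient of the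
  product have the same sign.
\<close>
lemma prod_linear_coeff_sign:
  fixes S :: "real set"
  assumes "finite S"
  shows "(\<forall>x\<in>S. x \<ge> 0) \<Longrightarrow> k \<le> card S \<Longrightarrow> (-1) ^ (card S - k) * coeff (\<Prod>x\<in>S. [:- x, 1:]) k \<ge> 0"
    and "(\<forall>x\<in>S. x > 0) \<Longrightarrow> k \<le> card S \<Longrightarrow> (-1) ^ (card S - k) * coeff (\<Prod>x\<in>S. [:- x, 1:]) k > 0"
proof -
  let ?c = "\<lambda>S k. coeff (\<Prod>x\<in>S. [:- x, 1:]) k :: real"
  have rec: "(-1) ^ (Suc (card F) - k) * ?c (insert a F) k
      = (if k \<le> card F then a * ((-1) ^ (card F - k) * ?c F k) else 0)
      + (if k = 0 then 0 else (-1) ^ (card F - (k - 1)) * ?c F (k - 1))"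
    if F: "finite F" "a \<notin> F" and k: "k \<le> Suc (card F)" for F k and a :: real
  proof -
    have "degree (\<Prod>x\<in>F. [:- x, 1:]) = card F" using F by (subst degree_prod_eq_sum_degree) auto
    then have z: "?c F k = 0" if "k > card F" using that by (simp add: coeff_eq_0)
    have E: "?c (insert a F) k = - a * ?c F k + (if k = 0 then 0 else ?c F (k - 1))"
      using F by (cases k) (simp_all add: coeff_pCons)
    have "card F - (k - 1) = Suc (card F - k)" if "k > 0" "k \<le> card F" using that by simp
    then show ?thesis
    proof (cases "k = 0")
      case True
      with E have "?c (insert a F) 0 = - a * ?c F 0" by simp
      then show ?thesis by (simp add: True)
    next
      case False
      with \<open>k > 0 \<Longrightarrow> k \<le> card F \<Longrightarrow> _\<close> k z show ?thesis
        by (cases "k \<le> card F") (simp_all add: E Suc_diff_le right_diff_distrib distrib_left mult_ac)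
    qed
  qed
  show "(\<forall>x\<in>S. x \<ge> 0) \<Longrightarrow> k \<le> card S \<Longrightarrow> (-1) ^ (card S - k) * ?c S k \<ge> 0"
    using assms
  proof (induction S arbitrary: k rule: finite_induct)
    case (insert a F)
    have IH: "(-1) ^ (card F - j) * ?c F j \<ge> 0" if "j \<le> card F" for j
      using insert.IH[OF _ that] insert.prems by simp
    have a: "a \<ge> 0" and k: "k \<le> Suc (card F)" and card: "card (insert a F) = Suc (card F)"
      using insert by simp_all
    show ?case
      unfolding card rec[OF insert.hyps(1,2) k]
      using IH[of k] IH[of "k - 1"] a k by (auto intro!: add_nonneg_nonneg mult_nonneg_nonneg[of a])
  qed simp
  show "(\<forall>x\<in>S. x > 0) \<Longrightarrow> k \<le> card S \<Longrightarrow> (-1) ^ (card S - k) * ?c S k > 0"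
    using assms
  proof (induction S arbitrary: k rule: finite_induct)
    case (insert a F)
    have IH: "(-1) ^ (card F - j) * ?c F j > 0" if "j \<le> card F" for j
      using insert.IH[OF _ that] insert.prems by simp
    have a: "a > 0" and k: "k \<le> Suc (card F)" and card: "card (insert a F) = Suc (card F)"
      using insert by simp_all
    show ?case
      unfolding card rec[OF insert.hyps(1,2) k]
      using IH[of k] IH[of "k - 1"] a k by (auto intro!: add_pos_pos mult_pos_pos[of a])
  qed simp
qed

lemma alternating_if_positive_roots:
  assumes "lead_coeff f > 0" "card {x. poly f x = 0} = degree f" "\<And>x. poly f x = 0 \<Longrightarrow> x > 0"
  shows "alternating (degree f) f"
proof -
  let ?S = "{x. poly f x = 0}"
  have f: "f \<noteq> 0" using assms(1) by auto
  have fin: "finite ?S" using f poly_roots_finite by blast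
  show ?thesis unfolding alternating_def
  proof (intro allI impI)
    fix k assume k: "k \<le> degree f"
    have "(-1) ^ (degree f - k) * coeff f k
        = lead_coeff f * ((-1) ^ (card ?S - k) * coeff (\<Prod>x\<in>?S. [:- x, 1:]) k)"
      by (subst (2) real_rooted_factor[OF f assms(2)]) (simp add: assms(2))
    also have "\<dots> > 0"
      using prod_linear_coeff_sign(2)[OF fin] assms k by (intro mult_pos_pos[OF assms(1)]) auto
    finally show "(-1) ^ (degree f - k) * coeff f k > 0" .
  qed
qed

text \<open>
  In the partial fraction expansion \<open>B\<close> is a positive combination of the products that omit one linear
  factor. Each has weakly alternating coefficients, and the one that omits the smallest root has only
  positive roots left, so strictness holds even if \<open>0\<close> is a root of \<open>A\<close>.
\<close>
lemma alternating_if_interlaced: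
  assumes A: "lead_coeff A > 0" and I: "interlaced A B" and B: "B = 0 \<or> degree B < degree A"
    and nn: "\<And>x. poly A x = 0 \<Longrightarrow> x \<ge> 0" and d: "degree A > 0"
  shows "alternating (degree A - 1) B"
proof -
  let ?S = "{x. poly A x = 0}"
  have A0: "A \<noteq> 0" using A by auto
  have fin: "finite ?S" using A0 poly_roots_finite by blast
  have card: "card ?S = degree A" using I by (simp add: interlaced_def)
  obtain w where w: "\<And>x. poly A x = 0 \<Longrightarrow> lead_coeff A * w x > 0"
    and Bw: "B = (\<Sum>x\<in>?S. Polynomial.smult (w x) (\<Prod>y\<in>?S - {x}. [:- y, 1:]))"
    using interlaced_partial_fractions[OF A0 I, of 0 B] B by auto
  have ne: "?S \<noteq> {}" using card d by (metis card.empty less_irrefl)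
  define x0 where "x0 = Min ?S"
  have x0: "x0 \<in> ?S" using fin ne unfolding x0_def by (rule Min_in)
  have x0_less: "y > 0" if "y \<in> ?S - {x0}" for y
  proof -
    have "x0 \<le> y" using fin that by (simp add: x0_def)
    moreover have "x0 \<ge> 0" using nn x0 by auto
    ultimately show ?thesis using that by auto
  qed
  show ?thesis unfolding alternating_def
  proof (intro allI impI)
    fix k assume k: "k \<le> degree A - 1"
    let ?c = "\<lambda>x. (-1) ^ (degree A - 1 - k) * coeff (\<Prod>y\<in>?S - {x}. [:- y, 1:]) k"
    have cd: "card (?S - {x}) = degree A - 1" if "x \<in> ?S" for x using fin that card by simp
    have "(-1) ^ (degree A - 1 - k) * coeff B k = (\<Sum>x\<in>?S. w x * ?c x)"
      by (subst Bw) (simp add: coeff_sum sum_distrib_left mult_ac)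
    also have "\<dots> > 0"
    proof (rule sum_pos2[OF fin x0])
      have wp: "w x > 0" if "x \<in> ?S" for x using w[of x] that A by (simp add: zero_less_mult_iff)
      have "(-1) ^ (card (?S - {x0}) - k) * coeff (\<Prod>y\<in>?S - {x0}. [:- y, 1:]) k > 0"
        using fin x0_less k cd[OF x0] by (intro prod_linear_coeff_sign(2)) auto
      then show "0 < w x0 * ?c x0"
        unfolding cd[OF x0] by (rule mult_pos_pos[OF wp[OF x0]])
      show "0 \<le> w x * ?c x" if x: "x \<in> ?S" for x
      proof -
        have "(-1) ^ (card (?S - {x}) - k) * coeff (\<Prod>y\<in>?S - {x}. [:- y, 1:]) k \<ge> 0"
          using fin nn k cd[OF x] by (intro prod_linear_coeff_sign(1)) auto
        then show ?thesis
          unfolding cd[OF x] by (rule mult_nonneg_nonneg[OF less_imp_le[OF wp[OF x]]])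
      qed
    qed
    finally show "(-1) ^ (degree A - 1 - k) * coeff B k > 0" .
  qed
qed

lemma pderiv_sign_smallest_root:
  fixes f :: "real poly"
  assumes "lead_coeff f > 0" "card {x. poly f x = 0} = degree f" "poly f x = 0"
    "\<And>y. poly f y = 0 \<Longrightarrow> x \<le> y"
  shows "(-1) ^ (degree f - 1) * poly (pderiv f) x > 0"
proof -
  let ?S = "{x. poly f x = 0}"
  have f: "f \<noteq> 0" using assms(1) by auto
  have fin: "finite ?S" using f poly_roots_finite by blast
  have "(\<Prod>y\<in>?S - {x}. x - y) = (\<Prod>y\<in>?S - {x}. (-1) * (y - x))" by simp
  also have "\<dots> = (-1) ^ (degree f - 1) * (\<Prod>y\<in>?S - {x}. y - x)"
    using fin assms by (simp only: prod.distrib prod_constant) simp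
  finally have "(-1) ^ (degree f - 1) * poly (pderiv f) x = lead_coeff f * (\<Prod>y\<in>?S - {x}. y - x)"
    using pderiv_at_root[OF f assms(2,3)] by (cases "even (degree f - 1)") simp_all
  also have "\<dots> > 0"
    using assms by (intro mult_pos_pos prod_pos) (auto simp: order_less_le)
  finally show ?thesis .
qed

text \<open>
  Factor by factor: \<open>- y\<close> and \<open>x - y\<close> have the same sign for every other root \<open>y\<close>, because no root
  lies between \<open>x\<close> and \<open>0\<close>.
\<close>
lemma pderiv_sign_largest_negative_root:
  fixes f :: "real poly"
  assumes "f \<noteq> 0" "card {x. poly f x = 0} = degree f" "poly f x = 0" "x < 0" "poly f 0 \<noteq> 0"
    "\<And>y. poly f y = 0 \<Longrightarrow> y < 0 \<Longrightarrow> y \<le> x"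
  shows "poly f 0 * poly (pderiv f) x > 0"
proof -
  let ?S = "{x. poly f x = 0}"
  have fin: "finite ?S" using assms(1) by (rule poly_roots_finite)
  have "poly f 0 = poly (Polynomial.smult (lead_coeff f) (\<Prod>x\<in>?S. [:- x, 1:])) 0"
    using real_rooted_factor[OF assms(1,2)] by (rule arg_cong[where f = "\<lambda>q. poly q 0"])
  also have "\<dots> = lead_coeff f * (\<Prod>y\<in>?S. - y)"
  proof -
    have "poly [:- y, 1:] 0 = - y" for y :: real by simp
    then show ?thesis by (simp only: poly_smult poly_prod)
  qed
  also have "(\<Prod>y\<in>?S. - y) = - x * (\<Prod>y\<in>?S - {x}. - y)"
    using fin assms by (intro prod.remove) auto
  finally have "poly f 0 * poly (pderiv f) x = (lead_coeff f * (- x * (\<Prod>y\<in>?S - {x}. - y)))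
      * (lead_coeff f * (\<Prod>y\<in>?S - {x}. x - y))"
    by (simp only: pderiv_at_root[OF assms(1-3)])
  also have "\<dots> = (lead_coeff f)\<^sup>2 * (- x) * ((\<Prod>y\<in>?S - {x}. - y) * (\<Prod>y\<in>?S - {x}. x - y))"
    by (simp only: power2_eq_square mult_ac)
  also have "(\<Prod>y\<in>?S - {x}. - y) * (\<Prod>y\<in>?S - {x}. x - y) = (\<Prod>y\<in>?S - {x}. - y * (x - y))"
    by (rule prod.distrib[symmetric])
  also have "(lead_coeff f)\<^sup>2 * (- x) * (\<Prod>y\<in>?S - {x}. - y * (x - y)) > 0"
  proof (rule mult_pos_pos[OF _ prod_pos])
    show "(lead_coeff f)\<^sup>2 * (- x) > 0" using assms(1,4) by (intro mult_pos_pos) auto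
    fix y assume y: "y \<in> ?S - {x}"
    then have "y \<noteq> 0" using assms(5) by auto
    then consider "y > 0" | "y < 0" by linarith
    then show "- y * (x - y) > 0"
    proof cases
      case 1
      then show ?thesis using assms(4) by (intro mult_neg_neg) auto
    next
      case 2
      then show ?thesis using assms(6)[of y] y by (intro mult_pos_pos) auto
    qed
  qed
  finally show ?thesis .
qed

lemma largest_negative_root:
  fixes f :: "real poly"
  assumes "f \<noteq> 0" "\<exists>x<0. poly f x = 0"
  obtains x where "poly f x = 0" "x < 0" "\<And>y. poly f y = 0 \<Longrightarrow> y < 0 \<Longrightarrow> y \<le> x"
proof -
  let ?S = "{x. poly f x = 0 \<and> x < 0}"
  have fin: "finite ?S" using poly_roots_finite[OF assms(1)] by (rule rev_finite_subset) auto
  have "Max ?S \<in> ?S" using fin assms(2) by (intro Max_in) auto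
  then show thesis using that[of "Max ?S"] fin by auto
qed

lemma smallest_root:
  fixes f :: "real poly"
  assumes "f \<noteq> 0" "poly f y = 0"
  obtains x where "poly f x = 0" "x \<le> y" "\<And>y. poly f y = 0 \<Longrightarrow> x \<le> y"
proof -
  let ?S = "{x. poly f x = 0}"
  have fin: "finite ?S" using poly_roots_finite[OF assms(1)] .
  have "Min ?S \<in> ?S" using fin assms(2) by (intro Min_in) auto
  then show thesis using that[of "Min ?S"] fin assms(2) by auto
qed

lemma mult_pos_if_same_sign:
  fixes a b :: real
  assumes "(-1) ^ m * a > 0" "(-1) ^ m * b > 0" shows "a * b > 0"
  using assms by (cases "even m") (auto intro: mult_pos_pos mult_neg_neg)

text \<open>
  Suppose the coefficients of \<open>g\<close> alternate and \<open>f\<close> has a negative root. At the largest one \<open>f'\<close> has the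
  sign of \<open>f(0)\<close>, which is opposite to that of \<open>g\<close> on the negative axis; so \<open>(f, g)\<close> is not
  interlaced. At the smallest one \<open>f'\<close> has the same sign as \<open>g\<close>, so \<open>(f, u g)\<close> is not interlaced.
\<close>
lemma even_criterion:
  assumes f: "lead_coeff f > 0" "degree f = m" "m > 0" and g: "g = 0 \<or> degree g < m"
  defines "C \<equiv> interlaced f g \<and> (\<forall>x. poly f x = 0 \<longrightarrow> x > 0)"
  defines "c1 \<equiv> alternating m f"
  defines "c2 \<equiv> (-1) ^ m * poly f 0 > 0 \<and> alternating (m - 1) g"
  defines "d1 \<equiv> interlaced f g" and "d2 \<equiv> interlaced f (pCons 0 g)"
  shows "C \<Longrightarrow> c1 \<and> c2 \<and> d1 \<and> d2" and "c1 \<or> c2 \<Longrightarrow> d1 \<or> d2 \<Longrightarrow> C"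
proof -
  have f0: "f \<noteq> 0" using f by auto
  have d2f: "interlaced f (pCons 0 g) \<longleftrightarrow> card {x. poly f x = 0} = degree f \<and>
    (\<forall>x. poly f x = 0 \<longrightarrow> x * (poly g x * poly (pderiv f) x) > 0)"
    by (simp add: interlaced_def mult.assoc)
  { assume C: C
    then have card: "card {x. poly f x = 0} = degree f" by (simp add: C_def interlaced_def)
    have c1 using alternating_if_positive_roots[OF f(1) card] C f by (auto simp: c1_def C_def)
    moreover have c2
      using alternating_if_interlaced[of f g] alternating_sign[of m f 0] C f g \<open>c1\<close>
      by (auto simp: c1_def c2_def C_def less_imp_le)
    moreover have d2
      unfolding d2_def d2f
    proof (intro conjI card allI impI)
      fix x assume "poly f x = 0"
      then show "x * (poly g x * poly (pderiv f) x) > 0"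
        using C by (intro mult_pos_pos[of x]) (auto simp: C_def interlaced_def)
    qed
    ultimately show "c1 \<and> c2 \<and> d1 \<and> d2" using C by (simp add: C_def d1_def) }
  assume c: "c1 \<or> c2" and d: "d1 \<or> d2"
  then have card: "card {x. poly f x = 0} = degree f" by (auto simp: d1_def d2_def interlaced_def)
  have pos: "x > 0" if x: "poly f x = 0" for x
  proof (rule ccontr)
    assume nx: "\<not> x > 0"
    show False
    proof (cases c1)
      case True
      then show False using alternating_sign[of m f x] x nx f by (simp add: c1_def)
    next
      case False
      with c have c2: "(-1) ^ m * poly f 0 > 0" "alternating (m - 1) g" by (auto simp: c2_def)
      have f00: "poly f 0 \<noteq> 0" using c2 by auto
      have m: "(-1 :: real) ^ m = - ((-1) ^ (m - 1))" using f(3) by (cases m) auto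
      have gs: "(-1) ^ (m - 1) * poly g y > 0" if "y < 0" for y
        using that g f(3) by (intro alternating_sign c2) auto
      have neg: "\<exists>x<0. poly f x = 0" using x nx f00 by (metis not_less_iff_gr_or_eq)
      from d show False
      proof
        assume d1
        obtain y where y: "poly f y = 0" "y < 0" "\<And>z. poly f z = 0 \<Longrightarrow> z < 0 \<Longrightarrow> z \<le> y"
          using largest_negative_root[OF f0 neg] by blast
        have "poly f 0 * poly (pderiv f) y > 0"
          by (rule pderiv_sign_largest_negative_root[OF f0 card y(1,2) f00 y(3)])
        moreover have "poly g y * poly (pderiv f) y > 0" using \<open>d1\<close> y(1) by (auto simp: d1_def interlaced_def)
        moreover have "poly g y * - poly f 0 > 0"
          using mult_pos_if_same_sign[of "m - 1" "poly g y" "- poly f 0"] gs[OF y(2)] c2 m by simp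
        ultimately show False by (auto simp: zero_less_mult_iff mult_less_0_iff)
      next
        assume d2
        obtain y where y: "poly f y = 0" "y \<le> x" "\<And>z. poly f z = 0 \<Longrightarrow> y \<le> z"
          using smallest_root[OF f0 x] by blast
        have "y \<noteq> 0" using y(1) f00 by auto
        then have "y < 0" using y(2) nx by simp
        have "poly g y * poly (pderiv f) y > 0"
          using gs[OF \<open>y < 0\<close>] pderiv_sign_smallest_root[OF f(1) card y(1,3)] unfolding f(2)
          by (rule mult_pos_if_same_sign)
        moreover have "y * (poly g y * poly (pderiv f) y) > 0"
          using \<open>d2\<close> y(1) by (simp add: d2_def d2f)
        ultimately show False using mult_neg_pos[OF \<open>y < 0\<close>] by (metis not_less_iff_gr_or_eq)
      qed
    qed
  qed
  moreover have "interlaced f g"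
    using d
  proof
    assume d2
    show ?thesis unfolding interlaced_def
    proof (intro conjI card allI impI)
      fix x assume x: "poly f x = 0"
      then have "x * (poly g x * poly (pderiv f) x) > 0"
        using \<open>d2\<close> by (simp add: d2_def d2f)
      then show "poly g x * poly (pderiv f) x > 0" using pos[OF x] by (rule zero_less_mult_pos)
    qed
  qed (simp add: d1_def)
  ultimately show C by (simp add: C_def)
qed

text \<open>
  The roles are exchanged compared with the even case: without the factor \<open>u\<close> the contradiction comes
  from the smallest root of \<open>f\<close>, with it from the largest negative one. The root \<open>0\<close> of \<open>u f\<close> adds
  the condition that \<open>h(0)\<close> and \<open>f(0)\<close> have equal signs, which follows from either list of
  coefficient signs.
\<close>
lemma odd_criterion:
  assumes f: "lead_coeff f > 0" "degree f = m" and h: "degree h \<le> m"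
  defines "C \<equiv> interlaced (pCons 0 f) h \<and> (\<forall>x. poly f x = 0 \<longrightarrow> x > 0)"
  defines "c1 \<equiv> alternating m h"
  defines "c2 \<equiv> (-1) ^ m * poly h 0 > 0 \<and> alternating m f"
  defines "d1 \<equiv> interlaced f h" and "d2 \<equiv> interlaced (pCons 0 f) h"
  shows "C \<Longrightarrow> c1 \<and> c2 \<and> d1 \<and> d2" and "c1 \<or> c2 \<Longrightarrow> d1 \<or> d2 \<Longrightarrow> C"
proof -
  let ?F = "pCons 0 f"
  have f0: "f \<noteq> 0" using f by auto
  have F: "lead_coeff ?F > 0" "degree ?F = Suc m" using f f0 by auto
  have dF: "poly (pderiv ?F) x = poly f x + x * poly (pderiv f) x" for x by (simp add: pderiv_pCons)
  have rootsF: "{x. poly ?F x = 0} = insert 0 {x. poly f x = 0}" by auto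
  have fin: "finite {x. poly f x = 0}" using f0 poly_roots_finite by blast
  have cardF: "card {x. poly ?F x = 0} = degree ?F \<longleftrightarrow> card {x. poly f x = 0} = degree f" if "poly f 0 \<noteq> 0"
    unfolding rootsF using that fin F f by (simp add: card_insert_disjoint)
  have d2f: "interlaced ?F h \<longleftrightarrow> poly h 0 * poly f 0 > 0 \<and> card {x. poly f x = 0} = degree f \<and>
    (\<forall>x. poly f x = 0 \<longrightarrow> x * (poly h x * poly (pderiv f) x) > 0)"
  proof (cases "poly f 0 = 0")
    case True
    then show ?thesis by (auto simp: interlaced_def dF)
  next
    case False
    then show ?thesis unfolding interlaced_def cardF[OF False] by (auto simp: dF mult_ac)
  qed
  { assume C: C
    then have card: "card {x. poly f x = 0} = degree f" by (simp add: C_def d2f)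
    have af: "alternating m f" using alternating_if_positive_roots[OF f(1) card] C f by (auto simp: C_def)
    have c1
    proof -
      have "x \<ge> 0" if "poly ?F x = 0" for x using C that by (auto simp: C_def less_imp_le)
      then have "alternating (degree ?F - 1) h"
        using C h F by (intro alternating_if_interlaced) (simp_all add: C_def less_Suc_eq_le)
      then show ?thesis using F(2) by (simp add: c1_def)
    qed
    moreover have c2
      using alternating_sign[of m h 0] h af \<open>c1\<close> by (auto simp: c1_def c2_def)
    moreover have d1
      unfolding d1_def interlaced_def
    proof (intro conjI card allI impI)
      fix x assume x: "poly f x = 0"
      then have "x * (poly h x * poly (pderiv f) x) > 0" "x > 0" using C by (simp_all add: C_def d2f)
      then show "poly h x * poly (pderiv f) x > 0" by (rule zero_less_mult_pos)
    qed
    ultimately show "c1 \<and> c2 \<and> d1 \<and> d2" using C by (simp add: C_def d2_def) }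
  assume c: "c1 \<or> c2" and d: "d1 \<or> d2"
  have card: "card {x. poly f x = 0} = degree f"
    using d by (auto simp: d1_def d2_def d2f interlaced_def[of f])
  have h0: "(-1) ^ m * poly h 0 > 0"
    using c alternating_sign[of m h 0] h by (auto simp: c1_def c2_def)
  have pos: "x > 0" if x: "poly f x = 0" for x
  proof (rule ccontr)
    assume nx: "\<not> x > 0"
    show False
    proof (cases c2)
      case True
      then show False using alternating_sign[of m f x] x nx f by (simp add: c2_def)
    next
      case False
      with c have c1: "alternating m h" by (auto simp: c1_def)
      have hs: "(-1) ^ m * poly h y > 0" if "y \<le> 0" for y
        using that h by (intro alternating_sign c1) auto
      have m: "m > 0"
        using card x f fin by (metis card_eq_0_iff empty_iff gr0I mem_Collect_eq)
      from d show False
      proof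
        assume d1
        obtain y where y: "poly f y = 0" "y \<le> x" "\<And>z. poly f z = 0 \<Longrightarrow> y \<le> z"
          using smallest_root[OF f0 x] by blast
        have "(-1) ^ m * (- poly (pderiv f) y) > 0"
        proof -
          have "(-1) ^ (m - 1) * poly (pderiv f) y > 0"
            using pderiv_sign_smallest_root[OF f(1) card y(1,3)] unfolding f(2) .
          then show ?thesis using m by (cases m) simp_all
        qed
        with hs[of y] y(2) nx have "poly h y * - poly (pderiv f) y > 0"
          using mult_pos_if_same_sign[of m "poly h y" "- poly (pderiv f) y"] by auto
        moreover have "poly h y * poly (pderiv f) y > 0" using \<open>d1\<close> y(1) by (auto simp: d1_def interlaced_def)
        ultimately show False by simp
      next
        assume d2
        then have D: "poly h 0 * poly f 0 > 0" "\<And>x. poly f x = 0 \<Longrightarrow> x * (poly h x * poly (pderiv f) x) > 0"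
          by (auto simp: d2_def d2f)
        have f00: "poly f 0 \<noteq> 0" using D by auto
        have neg: "\<exists>x<0. poly f x = 0" using x nx f00 by (metis not_less_iff_gr_or_eq)
        obtain y where y: "poly f y = 0" "y < 0" "\<And>z. poly f z = 0 \<Longrightarrow> z < 0 \<Longrightarrow> z \<le> y"
          using largest_negative_root[OF f0 neg] by blast
        have "poly f 0 * poly (pderiv f) y > 0"
          by (rule pderiv_sign_largest_negative_root[OF f0 card y(1,2) f00 y(3)])
        moreover have "poly h 0 * poly h y > 0"
          using mult_pos_if_same_sign[OF h0 hs[of y]] y(2) by simp
        moreover note D(1) D(2)[OF y(1)] y(2)
        ultimately show False by (auto simp: zero_less_mult_iff mult_less_0_iff)
      qed
    qed
  qed
  moreover have "interlaced ?F h"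
  proof -
    have "(-1) ^ m * poly f 0 > 0"
      using alternating_if_positive_roots[OF f(1) card pos] f by (intro alternating_sign) auto
    then have "poly h 0 * poly f 0 > 0" by (rule mult_pos_if_same_sign[OF h0])
    moreover have "x * (poly h x * poly (pderiv f) x) > 0" if x: "poly f x = 0" for x
      using d
    proof
      assume d1
      then have "poly h x * poly (pderiv f) x > 0" using x by (auto simp: d1_def interlaced_def)
      then show ?thesis using pos[OF x] by (rule mult_pos_pos[rotated])
    next
      assume d2
      then show ?thesis using x by (auto simp: d2_def d2f)
    qed
    ultimately show ?thesis using card by (auto simp: d2f)
  qed
  ultimately show C by (simp add: C_def)
qed

section \<open>The criterion\<close>

definition even_part :: "real poly \<Rightarrow> real poly" where
  "even_part p = Abs_poly (\<lambda>k. coeff p (2 * k))"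

definition odd_part :: "real poly \<Rightarrow> real poly" where
  "odd_part p = Abs_poly (\<lambda>k. coeff p (2 * k + 1))"

lemma coeff_even_part: "coeff (even_part p) k = coeff p (2 * k)"
  unfolding even_part_def by (subst coeff_Abs_poly[of "degree p"]) (auto simp: coeff_eq_0)

lemma coeff_odd_part: "coeff (odd_part p) k = coeff p (2 * k + 1)"
  unfolding odd_part_def by (subst coeff_Abs_poly[of "degree p"]) (auto simp: coeff_eq_0)

lemma poly_even_odd_split: "poly p x = poly (even_part p) (x\<^sup>2) + x * poly (odd_part p) (x\<^sup>2)"
proof (induction p)
  case 0
  have "even_part 0 = 0" "odd_part 0 = 0"
    by (auto intro!: poly_eqI simp: coeff_even_part coeff_odd_part)
  then show ?case by simp
next
  case (pCons a p)
  have "even_part (pCons a p) = pCons a (odd_part p)" "odd_part (pCons a p) = even_part p"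
    by (auto intro!: poly_eqI simp: coeff_even_part coeff_odd_part coeff_pCons split: nat.splits)
  then show ?case by (simp add: pCons.IH power2_eq_square algebra_simps)
qed

lemma even_odd_split:
  "p = pcompose (even_part p) sq + pCons 0 (pcompose (odd_part p) sq)"
  by (rule poly_ext) (subst poly_even_odd_split, simp add: poly_sq)

text \<open>
  \<open>p\<close> and \<open>- p(-z)\<close> are the sum and the difference of \<open>f(z\<^sup>2)\<close> and \<open>z g(z\<^sup>2)\<close>, up to sign. The part that
  carries the leading term of \<open>p\<close> has to come first in the pair.
\<close>
lemma self_interlacing_even:
  assumes "degree p = 2 * m" "m > 0"
  shows "self_interlacing_I p \<longleftrightarrow>
    interlaced (even_part p) (odd_part p) \<and> (\<forall>x. poly (even_part p) x = 0 \<longrightarrow> x > 0)"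
proof -
  let ?f = "even_part p" and ?g = "odd_part p"
  let ?A = "pcompose ?f sq" and ?B = "pCons 0 (pcompose ?g sq)"
  have p0: "p \<noteq> 0" using assms by auto
  have "coeff ?f m \<noteq> 0" using p0 assms by (metis coeff_even_part leading_coeff_0_iff)
  moreover have "degree ?f \<le> m" using assms by (intro degree_le) (auto simp: coeff_even_part coeff_eq_0)
  ultimately have f: "?f \<noteq> 0" "degree ?f = m" by (auto simp: le_degree antisym)
  have g: "degree ?g \<le> m - 1" using assms by (intro degree_le) (auto simp: coeff_odd_part coeff_eq_0)
  have deg: "degree ?B < degree ?A"
    using f g assms degree_pCons_le[of 0 "pcompose ?g sq"] by (simp add: degree_pcompose)
  have p: "p = ?A + Polynomial.smult 1 ?B" using even_odd_split[of p] by simp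
  have q: "poly (?B - Polynomial.smult 1 ?A) x = - poly p (- x)" for x
    by (simp add: poly_even_odd_split[of p] poly_sq)
  have "self_interlacing_I p \<longleftrightarrow> interlaced p (?B - Polynomial.smult 1 ?A)"
    using assms q by (intro self_interlacing_iff_interlaced) auto
  also have "\<dots> \<longleftrightarrow> interlaced (?A + Polynomial.smult 1 ?B) (?B - Polynomial.smult 1 ?A)"
    using p by simp
  also have "\<dots> \<longleftrightarrow> interlaced ?A ?B" by (rule interlaced_rotate[OF deg]) simp
  also have "\<dots> \<longleftrightarrow> interlaced ?f ?g \<and> (\<forall>x. poly ?f x = 0 \<longrightarrow> x > 0)"
    by (rule interlaced_square_even[OF f(1)])
  finally show ?thesis .
qed

lemma self_interlacing_odd:
  assumes "degree p = 2 * m + 1"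
  shows "self_interlacing_I p \<longleftrightarrow>
    interlaced (pCons 0 (odd_part p)) (- even_part p) \<and> (\<forall>x. poly (odd_part p) x = 0 \<longrightarrow> x > 0)"
proof -
  let ?f = "odd_part p" and ?h = "- even_part p"
  let ?A = "pCons 0 (pcompose ?f sq)" and ?B = "pcompose ?h sq"
  have p0: "p \<noteq> 0" using assms by auto
  have "coeff ?f m \<noteq> 0" using p0 assms by (metis coeff_odd_part leading_coeff_0_iff)
  moreover have "degree ?f \<le> m" using assms by (intro degree_le) (auto simp: coeff_odd_part coeff_eq_0)
  ultimately have f: "?f \<noteq> 0" "degree ?f = m" by (auto simp: le_degree antisym)
  have h: "degree ?h \<le> m" using assms by (intro degree_le) (auto simp: coeff_even_part coeff_eq_0)
  have deg: "degree ?B < degree ?A"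
    using f h by (simp add: degree_pcompose pcompose_eq_0_iff)
  have p: "p = ?A + Polynomial.smult (- 1) ?B"
    using even_odd_split[of p] by (simp add: pcompose_uminus add.commute)
  have q: "poly (?B - Polynomial.smult (- 1) ?A) x = - poly p (- x)" for x
    by (simp add: poly_even_odd_split[of p] poly_sq)
  have "self_interlacing_I p \<longleftrightarrow> interlaced p (?B - Polynomial.smult (- 1) ?A)"
    using assms q by (intro self_interlacing_iff_interlaced) auto
  also have "\<dots> \<longleftrightarrow> interlaced (?A + Polynomial.smult (- 1) ?B) (?B - Polynomial.smult (- 1) ?A)"
    using p by simp
  also have "\<dots> \<longleftrightarrow> interlaced ?A ?B" by (rule interlaced_rotate[OF deg]) simp
  also have "\<dots> \<longleftrightarrow> interlaced (pCons 0 ?f) ?h \<and> (\<forall>x. poly ?f x = 0 \<longrightarrow> x > 0)"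
    by (rule interlaced_square_odd[OF f(1)])
  finally show ?thesis .
qed

lemma hurwitz_det_hdet:
  "hurwitz_det p j = hdet j (\<lambda>i. desc_coeff p (2 * i)) (\<lambda>i. desc_coeff p (2 * i + 1))"
proof -
  have "hurwitz_matrix p j = mat j j (\<lambda>(r, s). (if even r then (\<lambda>i. desc_coeff p (2 * i + 1))
      else (\<lambda>i. desc_coeff p (2 * i))) (int s - int (r div 2)))"
    unfolding hurwitz_matrix_def
    by (intro eq_matI) (auto elim!: evenE oddE simp: algebra_simps)
  then show ?thesis by (simp add: hurwitz_det_def hdet_def)
qed

text \<open>
  A row and a column in front of the Hurwitz matrix exchange the roles of the two
  sequences. This turns determinants of even order into determinants of odd order, for which the
  interlacing criterion is stated.
\<close>
lemma hdet_prepend: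
  assumes "\<And>i. i < 0 \<Longrightarrow> f i = 0" "\<And>i. i < 0 \<Longrightarrow> g i = 0"
  shows "hdet (Suc j) (\<lambda>i. g (i - 1)) f = f 0 * hdet j f g"
  using hdet_Routh_step[of f "\<lambda>i. g (i - 1)" 0 j] assms by simp

lemma desc_coeff_even:
  assumes "degree p = 2 * m"
  shows "desc_coeff p (2 * i) = coeff_from_top (int m) (even_part p) i"
    and "desc_coeff p (2 * i + 1) = coeff_from_top (int m - 1) (odd_part p) i"
proof -
  show "desc_coeff p (2 * i) = coeff_from_top (int m) (even_part p) i"
  proof (cases "0 \<le> i \<and> i \<le> int m")
    case True
    then have "2 * m - nat (2 * i) = 2 * nat (int m - i)" by (simp add: nat_mult_distrib nat_diff_distrib diff_mult_distrib2)
    with True show ?thesis by (simp add: desc_coeff_def coeff_from_top_def assms coeff_even_part)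
  qed (auto simp: desc_coeff_def coeff_from_top_def assms)
  show "desc_coeff p (2 * i + 1) = coeff_from_top (int m - 1) (odd_part p) i"
  proof (cases "0 \<le> i \<and> i \<le> int m - 1")
    case True
    then have "2 * m - nat (2 * i + 1) = 2 * nat (int m - 1 - i) + 1" by linarith
    with True show ?thesis by (simp add: desc_coeff_def coeff_from_top_def assms coeff_odd_part)
  qed (auto simp: desc_coeff_def coeff_from_top_def assms)
qed

lemma desc_coeff_odd:
  assumes "degree p = 2 * m + 1"
  shows "desc_coeff p (2 * i) = coeff_from_top (int m) (odd_part p) i"
    and "desc_coeff p (2 * i + 1) = coeff_from_top (int m) (even_part p) i"
proof -
  show "desc_coeff p (2 * i) = coeff_from_top (int m) (odd_part p) i"
  proof (cases "0 \<le> i \<and> i \<le> int m")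
    case True
    then have "2 * m + 1 - nat (2 * i) = 2 * nat (int m - i) + 1" by linarith
    with True show ?thesis by (simp add: desc_coeff_def coeff_from_top_def assms coeff_odd_part)
  qed (auto simp: desc_coeff_def coeff_from_top_def assms)
  show "desc_coeff p (2 * i + 1) = coeff_from_top (int m) (even_part p) i"
  proof (cases "0 \<le> i \<and> i \<le> int m")
    case True
    then have "2 * m + 1 - nat (2 * i + 1) = 2 * nat (int m - i)" by linarith
    with True show ?thesis by (simp add: desc_coeff_def coeff_from_top_def assms coeff_even_part)
  qed (auto simp: desc_coeff_def coeff_from_top_def assms)
qed

lemma reverse_bounded_all:
  fixes P :: "nat \<Rightarrow> bool"
  shows "(\<forall>k<m. P (m - 1 - k)) \<longleftrightarrow> (\<forall>j<m. P j)"
proof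
  assume *: "\<forall>k<m. P (m - 1 - k)"
  show "\<forall>j<m. P j"
  proof (intro allI impI)
    fix j assume "j < m"
    then show "P j" using *[rule_format, of "m - 1 - j"] by simp
  qed
qed simp

lemma alternating_upto:
  assumes "m > 0"
  shows "alternating (m - 1) g \<longleftrightarrow> (\<forall>k\<ge>1. k \<le> m \<longrightarrow> (-1) ^ (m - k) * coeff g (k - 1) > 0)"
proof
  assume *: "\<forall>k\<ge>1. k \<le> m \<longrightarrow> (-1) ^ (m - k) * coeff g (k - 1) > 0"
  show "alternating (m - 1) g"
    unfolding alternating_def
  proof (intro allI impI)
    fix j assume "j \<le> m - 1"
    then show "(-1) ^ (m - 1 - j) * coeff g j > 0" using *[rule_format, of "Suc j"] assms by simp
  qed
next
  assume *: "alternating (m - 1) g"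
  show "\<forall>k\<ge>1. k \<le> m \<longrightarrow> (-1) ^ (m - k) * coeff g (k - 1) > 0"
  proof (intro allI impI)
    fix k :: nat assume "1 \<le> k" "k \<le> m"
    then show "(-1) ^ (m - k) * coeff g (k - 1) > 0"
      using *[unfolded alternating_def, rule_format, of "k - 1"] by simp
  qed
qed

lemma desc_coeff_from_end:
  assumes "j \<le> degree p"
  shows "desc_coeff p (int (degree p) - int j) = coeff p j"
proof -
  have "nat (int (degree p) - int j) = degree p - j" by linarith
  then show ?thesis using assms by (simp add: desc_coeff_def)
qed

text \<open>
  The odd-order determinants belong to the pair \<open>(f, g)\<close> itself. The even-order ones, after a row and a
  column have been prepended, belong to \<open>(- u g, f)\<close>, where the minus sign accounts for the alternating
  signs in the second determinant condition; by Euclidean division this pair tests whether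
  \<open>(f, u g)\<close> is interlaced.
\<close>
lemma sign_conditions_even_degree:
  assumes n: "degree p = 2 * m" and m: "m > 0" and lc: "lead_coeff p > 0"
  defines "f \<equiv> even_part p" and "g \<equiv> odd_part p"
  shows "coeff_signs_1 p \<longleftrightarrow> alternating m f"
    and "coeff_signs_2 p \<longleftrightarrow> (-1) ^ m * poly f 0 > 0 \<and> alternating (m - 1) g"
    and "det_signs_1 p \<longleftrightarrow> interlaced f g"
    and "det_signs_2 p \<longleftrightarrow> interlaced f (pCons 0 g)"
    and "lead_coeff f > 0" "degree f = m" "g = 0 \<or> degree g < m"
proof -
  have "degree f \<le> m" using n by (intro degree_le) (auto simp: f_def coeff_even_part coeff_eq_0)
  moreover have "coeff f m > 0" using lc n by (simp add: f_def coeff_even_part)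
  ultimately show f: "lead_coeff f > 0" "degree f = m"
    by (metis le_degree antisym less_irrefl)+
  have "degree g \<le> m - 1" using n m by (intro degree_le) (auto simp: g_def coeff_odd_part coeff_eq_0)
  then show g: "g = 0 \<or> degree g < m" using m by auto
  have dc: "desc_coeff p (int (2 * m) - int j) = coeff p j" if "j \<le> 2 * m" for j
    using desc_coeff_from_end[of j p] that unfolding n .
  have div: "(2 * m + 1) div 2 = m" by simp
  show "coeff_signs_1 p \<longleftrightarrow> alternating m f"
    using dc[of "2 * _"] by (auto simp: coeff_signs_1_def alternating_def n div f_def coeff_even_part)
  have "(2 * k - 1 \<le> 2 * m \<longrightarrow> (-1) ^ (m - k) * desc_coeff p (int (2 * m) - (2 * int k - 1)) > 0) \<longleftrightarrow>
      (k \<le> m \<longrightarrow> (-1) ^ (m - k) * coeff g (k - 1) > 0)" if "k \<ge> 1" for k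
  proof (cases "k \<le> m")
    case True
    then have "desc_coeff p (int (2 * m) - (2 * int k - 1)) = coeff p (2 * k - 1)"
      using that dc[of "2 * k - 1"] by (simp add: of_nat_diff)
    moreover have "2 * k - 1 = 2 * (k - 1) + 1" using that by simp
    moreover have "2 * k - 1 \<le> 2 * m" using True that by simp
    ultimately show ?thesis using True by (simp only: simp_thms g_def coeff_odd_part)
  qed auto
  then show "coeff_signs_2 p \<longleftrightarrow> (-1) ^ m * poly f 0 > 0 \<and> alternating (m - 1) g"
    unfolding coeff_signs_2_def Let_def n div alternating_upto[OF m]
    using dc[of 0] by (simp add: f_def poly_0_coeff_0 coeff_even_part)
  let ?F = "coeff_from_top (int m) f" and ?G = "coeff_from_top (int m - 1) g"
  have hd: "hurwitz_det p j = hdet j ?F ?G" for j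
    unfolding hurwitz_det_hdet f_def g_def desc_coeff_even[OF n] ..
  have "det_signs_1 p \<longleftrightarrow> (\<forall>k<m. hurwitz_det p (2 * (m - 1 - k) + 1) > 0)"
  proof -
    have "2 * k + 1 < 2 * m \<longleftrightarrow> k < m" for k by presburger
    moreover have "2 * m - (2 * k + 1) = 2 * (m - 1 - k) + 1" if "k < m" for k using that by simp
    ultimately show ?thesis unfolding det_signs_1_def Let_def n by (metis (no_types))
  qed
  also have "\<dots> \<longleftrightarrow> (\<forall>k<m. hurwitz_det p (2 * k + 1) > 0)"
    by (rule reverse_bounded_all[of m "\<lambda>j. hurwitz_det p (2 * j + 1) > 0"])
  also have "\<dots> \<longleftrightarrow> interlaced f g"
    using interlaced_iff_hdet[of f g] f g by (simp add: hd)
  finally show "det_signs_1 p \<longleftrightarrow> interlaced f g" .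
  have ug: "coeff_from_top (int m + 1) (- pCons 0 g) = (\<lambda>i. - 1 * ?G (i - 1))"
  proof
    fix i
    have "coeff g m = 0" using g by (auto simp: coeff_eq_0)
    moreover have "nat (int m + 1 - i) = Suc (nat (int m - i))" if "i \<le> int m" using that by linarith
    moreover have "nat (int m - 1 - (i - 1)) = nat (int m - i)" by simp
    ultimately show "coeff_from_top (int m + 1) (- pCons 0 g) i = - 1 * ?G (i - 1)"
      unfolding coeff_from_top_def by (auto simp: not_le)
  qed
  have step: "hdet (2 * j + 3) (coeff_from_top (int m + 1) (- pCons 0 g)) ?F
      = lead_coeff f * ((-1) ^ (j + 1) * hdet (2 * j + 2) ?F ?G)" for j
  proof -
    have "hdet (2 * (j + 1) + 1) (\<lambda>i. - 1 * ?G (i - 1)) (\<lambda>i. 1 * ?F i)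
        = (-1) ^ (j + 1) * 1 ^ (j + 1 + 1) * hdet (2 * (j + 1) + 1) (\<lambda>i. ?G (i - 1)) ?F"
      by (rule hdet_scale)
    also have "hdet (2 * (j + 1) + 1) (\<lambda>i. ?G (i - 1)) ?F = ?F 0 * hdet (2 * j + 2) ?F ?G"
      using hdet_prepend[of ?F ?G "2 * j + 2"] by (simp add: coeff_from_top_def)
    also have "?F 0 = lead_coeff f" by (simp add: coeff_from_top_def f(2))
    finally show ?thesis unfolding ug by (simp add: numeral_3_eq_3)
  qed
  have "det_signs_2 p \<longleftrightarrow>
      (\<forall>k<m. (-1) ^ (m - 1 - k + 1) * hurwitz_det p (2 * (m - 1 - k) + 2) > 0)"
  proof -
    have "2 * k < 2 * m \<longleftrightarrow> k < m" for k by presburger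
    moreover have "2 * m - 2 * k = 2 * (m - 1 - k) + 2" "m - k = m - 1 - k + 1" if "k < m" for k
      using that by simp_all
    ultimately show ?thesis unfolding det_signs_2_def Let_def n div by (metis (no_types))
  qed
  also have "\<dots> \<longleftrightarrow> (\<forall>j<m. (-1) ^ (j + 1) * hurwitz_det p (2 * j + 2) > 0)"
    by (rule reverse_bounded_all[of m "\<lambda>j. (-1) ^ (j + 1) * hurwitz_det p (2 * j + 2) > 0"])
  also have "\<dots> \<longleftrightarrow> (\<forall>j<m. hdet (2 * j + 3) (coeff_from_top (int m + 1) (- pCons 0 g)) ?F > 0)"
    using f(1) by (simp only: step hd zero_less_mult_iff[of "lead_coeff f"]) auto
  also have "\<dots> \<longleftrightarrow> interlaced f (- (- pCons 0 g))"
    using interlaced_uminus_iff_hdet[of f "- pCons 0 g"] f g degree_pCons_le[of 0 g] by (auto simp del: minus_pCons)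
  finally show "det_signs_2 p \<longleftrightarrow> interlaced f (pCons 0 g)" by simp
qed

text \<open>
  Here the even-order determinants belong, after prepending, to \<open>(g, f)\<close>, where \<open>g\<close> is the even part of
  \<open>p\<close>, and test whether \<open>(f, - g)\<close> is interlaced. The odd-order ones belong to \<open>(u f, g)\<close>, and
  replacing \<open>g\<close> by \<open>- g\<close> absorbs the alternating signs.
\<close>
lemma sign_conditions_odd_degree:
  assumes n: "degree p = 2 * m + 1" and lc: "lead_coeff p > 0"
  defines "f \<equiv> odd_part p" and "h \<equiv> - even_part p"
  shows "coeff_signs_1 p \<longleftrightarrow> alternating m h"
    and "coeff_signs_2 p \<longleftrightarrow> (-1) ^ m * poly h 0 > 0 \<and> alternating m f"
    and "det_signs_1 p \<longleftrightarrow> interlaced f h"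
    and "det_signs_2 p \<longleftrightarrow> interlaced (pCons 0 f) h"
    and "lead_coeff f > 0" "degree f = m" "degree h \<le> m"
proof -
  have "degree f \<le> m" using n by (intro degree_le) (auto simp: f_def coeff_odd_part coeff_eq_0)
  moreover have "coeff f m > 0" using lc n by (simp add: f_def coeff_odd_part)
  ultimately show f: "lead_coeff f > 0" "degree f = m"
    by (metis le_degree antisym less_irrefl)+
  show h: "degree h \<le> m" using n by (intro degree_le) (auto simp: h_def coeff_even_part coeff_eq_0)
  have dc: "desc_coeff p (int (2 * m + 1) - int j) = coeff p j" if "j \<le> 2 * m + 1" for j
    using desc_coeff_from_end[of j p] that unfolding n .
  have div: "(2 * m + 1 + 1) div 2 = m + 1" by simp
  have pw: "(-1 :: real) ^ (m + 1 - k) = - ((-1) ^ (m - k))" if "k \<le> m" for k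
    using that by (simp add: Suc_diff_le)
  have "(2 * k \<le> 2 * m + 1 \<longrightarrow> (-1) ^ (m + 1 - k) * desc_coeff p (int (2 * m + 1) - 2 * int k) > 0) \<longleftrightarrow>
      (k \<le> m \<longrightarrow> (-1) ^ (m - k) * coeff h k > 0)" for k
    using dc[of "2 * k"] pw[of k] by (cases "k \<le> m") (simp_all add: h_def coeff_even_part)
  then show "coeff_signs_1 p \<longleftrightarrow> alternating m h"
    unfolding coeff_signs_1_def Let_def n div alternating_def by (simp only:)
  have "(2 * k - 1 \<le> 2 * m + 1 \<longrightarrow> (-1) ^ (m + 1 - k) * desc_coeff p (int (2 * m + 1) - (2 * int k - 1)) > 0) \<longleftrightarrow>
      (k \<le> m + 1 \<longrightarrow> (-1) ^ (m + 1 - k) * coeff f (k - 1) > 0)" if "k \<ge> 1" for k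
  proof (cases "k \<le> m + 1")
    case True
    then have "desc_coeff p (int (2 * m + 1) - (2 * int k - 1)) = coeff p (2 * k - 1)"
      using that dc[of "2 * k - 1"] by (simp add: of_nat_diff)
    moreover have "2 * k - 1 = 2 * (k - 1) + 1" using that by simp
    moreover have "2 * k - 1 \<le> 2 * m + 1" using True that by simp
    ultimately show ?thesis using True by (simp only: simp_thms f_def coeff_odd_part)
  qed auto
  then show "coeff_signs_2 p \<longleftrightarrow> (-1) ^ m * poly h 0 > 0 \<and> alternating m f"
    unfolding coeff_signs_2_def Let_def n div
    using dc[of 0] alternating_upto[of "m + 1" f] by (simp add: h_def poly_0_coeff_0 coeff_even_part)
  let ?F = "coeff_from_top (int m) f" and ?G = "coeff_from_top (int m) (even_part p)"
  have hd: "hurwitz_det p j = hdet j ?F ?G" for j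
    unfolding hurwitz_det_hdet f_def desc_coeff_odd[OF n] ..
  have g: "coeff_from_top (int m + 1) (even_part p) = (\<lambda>i. ?G (i - 1))"
  proof
    fix i
    have "coeff (even_part p) (Suc m) = 0" using h by (auto simp: h_def coeff_eq_0)
    moreover have "nat (int m - (i - 1)) = nat (int m + 1 - i)" by simp
    ultimately show "coeff_from_top (int m + 1) (even_part p) i = ?G (i - 1)"
      unfolding coeff_from_top_def by (cases "i = 0") (auto simp: nat_add_distrib)
  qed
  have step: "hdet (2 * j + 3) (coeff_from_top (int m + 1) (even_part p)) ?F = lead_coeff f * hdet (2 * j + 2) ?F ?G" for j
    using hdet_prepend[of ?F ?G "2 * j + 2"] unfolding g
    by (simp add: coeff_from_top_def numeral_3_eq_3 f(2))
  have "det_signs_1 p \<longleftrightarrow> (\<forall>k<m. hurwitz_det p (2 * (m - 1 - k) + 2) > 0)"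
  proof -
    have "2 * k + 1 < 2 * m + 1 \<longleftrightarrow> k < m" for k by presburger
    moreover have "2 * m + 1 - (2 * k + 1) = 2 * (m - 1 - k) + 2" if "k < m" for k using that by simp
    ultimately show ?thesis unfolding det_signs_1_def Let_def n by (metis (no_types))
  qed
  also have "\<dots> \<longleftrightarrow> (\<forall>j<m. hurwitz_det p (2 * j + 2) > 0)"
    by (rule reverse_bounded_all[of m "\<lambda>j. hurwitz_det p (2 * j + 2) > 0"])
  also have "\<dots> \<longleftrightarrow> (\<forall>j<m. hdet (2 * j + 3) (coeff_from_top (int m + 1) (even_part p)) ?F > 0)"
    using f(1) by (simp only: step hd zero_less_mult_iff[of "lead_coeff f"]) auto
  also have "\<dots> \<longleftrightarrow> interlaced f h"
    using interlaced_uminus_iff_hdet[of f "even_part p"] f h by (simp add: h_def)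
  finally show "det_signs_1 p \<longleftrightarrow> interlaced f h" .
  have uf: "coeff_from_top (int m + 1) (pCons 0 f) = ?F"
  proof
    fix i
    have "nat (int m + 1 - i) = Suc (nat (int m - i))" if "i \<le> int m" using that by linarith
    then show "coeff_from_top (int m + 1) (pCons 0 f) i = ?F i"
      unfolding coeff_from_top_def by (cases "i = int m + 1") (auto simp: not_le)
  qed
  have hG: "coeff_from_top (int m) h = (\<lambda>i. - 1 * ?G i)" by (auto simp: coeff_from_top_def h_def)
  have sc: "hdet (2 * j + 1) ?F (coeff_from_top (int m) h) = (-1) ^ (j + 1) * hurwitz_det p (2 * j + 1)" for j
    using hdet_scale[of j 1 ?F "- 1" ?G] unfolding hG hd by simp
  have "det_signs_2 p \<longleftrightarrow>
      (\<forall>k<m + 1. (-1) ^ (m + 1 - 1 - k + 1) * hurwitz_det p (2 * (m + 1 - 1 - k) + 1) > 0)"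
  proof -
    have "2 * k < 2 * m + 1 \<longleftrightarrow> k < m + 1" for k by presburger
    moreover have "2 * m + 1 - 2 * k = 2 * (m + 1 - 1 - k) + 1" "m + 1 - k = m + 1 - 1 - k + 1"
      if "k < m + 1" for k using that by simp_all
    ultimately show ?thesis unfolding det_signs_2_def Let_def n div by (metis (no_types))
  qed
  also have "\<dots> \<longleftrightarrow> (\<forall>j<m + 1. (-1) ^ (j + 1) * hurwitz_det p (2 * j + 1) > 0)"
    by (rule reverse_bounded_all[of "m + 1" "\<lambda>j. (-1) ^ (j + 1) * hurwitz_det p (2 * j + 1) > 0"])
  also have "\<dots> \<longleftrightarrow> (\<forall>j<m + 1. hdet (2 * j + 1) ?F (coeff_from_top (int m) h) > 0)"
    by (simp only: sc)
  also have "\<dots> \<longleftrightarrow> interlaced (pCons 0 f) h"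
  proof -
    have "f \<noteq> 0" using f(1) by auto
    then have "lead_coeff (pCons 0 f) > 0" "degree (pCons 0 f) = m + 1" using f by simp_all
    moreover from this h have "h = 0 \<or> degree h < degree (pCons 0 f)" by simp
    ultimately have "interlaced (pCons 0 f) h \<longleftrightarrow> (\<forall>k<m + 1. hdet (2 * k + 1)
        (coeff_from_top (int (m + 1)) (pCons 0 f)) (coeff_from_top (int (m + 1) - 1) h) > 0)"
      using interlaced_iff_hdet[of "pCons 0 f" h] by simp
    moreover have "int (m + 1) = int m + 1" "int m + 1 - 1 = int m" by simp_all
    ultimately show ?thesis by (simp only: uf)
  qed
  finally show "det_signs_2 p \<longleftrightarrow> interlaced (pCons 0 f) h" .
qed

theorem theorem4p15:
  fixes p :: "real poly" and n :: nat
  assumes "degree p = n" and "n \<ge> 1" and "desc_coeff p 0 > 0"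
  shows "(self_interlacing_I p \<longleftrightarrow>
            (coeff_signs_1 p \<or> coeff_signs_2 p) \<and> (det_signs_1 p \<or> det_signs_2 p)) \<and>
         (self_interlacing_I p \<longleftrightarrow> coeff_signs_1 p \<and> det_signs_1 p) \<and>
         (self_interlacing_I p \<longleftrightarrow> coeff_signs_1 p \<and> det_signs_2 p) \<and>
         (self_interlacing_I p \<longleftrightarrow> coeff_signs_2 p \<and> det_signs_1 p) \<and>
         (self_interlacing_I p \<longleftrightarrow> coeff_signs_2 p \<and> det_signs_2 p)"
proof -
  have lc: "lead_coeff p > 0" using assms(3) by (simp add: desc_coeff_def)
  have "self_interlacing_I p \<Longrightarrow> coeff_signs_1 p \<and> coeff_signs_2 p \<and> det_signs_1 p \<and> det_signs_2 p"
    and "coeff_signs_1 p \<or> coeff_signs_2 p \<Longrightarrow> det_signs_1 p \<or> det_signs_2 p \<Longrightarrow> self_interlacing_I p"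
  proof (atomize (full), cases "even n")
    case True
    then obtain m where n: "degree p = 2 * m" using assms(1) by (auto elim: evenE)
    then have m: "m > 0" using assms by simp
    note s = sign_conditions_even_degree[OF n m lc]
    show "(self_interlacing_I p \<longrightarrow> coeff_signs_1 p \<and> coeff_signs_2 p \<and> det_signs_1 p \<and> det_signs_2 p) \<and>
      (coeff_signs_1 p \<or> coeff_signs_2 p \<longrightarrow> det_signs_1 p \<or> det_signs_2 p \<longrightarrow> self_interlacing_I p)"
      unfolding self_interlacing_even[OF n m] s(1-4)
      using even_criterion[OF s(5,6) m s(7)] by blast
  next
    case False
    then obtain m where n: "degree p = 2 * m + 1" using assms(1) by (auto elim: oddE)
    note s = sign_conditions_odd_degree[OF n lc]
    show "(self_interlacing_I p \<longrightarrow> coeff_signs_1 p \<and> coeff_signs_2 p \<and> det_signs_1 p \<and> det_signs_2 p) \<and>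
      (coeff_signs_1 p \<or> coeff_signs_2 p \<longrightarrow> det_signs_1 p \<or> det_signs_2 p \<longrightarrow> self_interlacing_I p)"
      unfolding self_interlacing_odd[OF n] s(1-4)
      using odd_criterion[OF s(5,6,7)] by blast
  qed
  then show ?thesis by blast
qed

end
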